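(* Let $\mathcal{A}$ be a finite list in a finitely generated abelian group $\Gamma$ and $G$ a torsion-wise finite abelian group. Then: (1) if $\mathcal{S}\subset\mathcal{A}$ and $\alpha\in\mathcal{A}$ satisfy $r_{\mathcal{S}\cup\{\alpha\}}=r_{\mathcal{S}}$, then $m(\mathcal{S}\cup\{\alpha\};G)$ divides $m(\mathcal{S};G)$; (2) if $r_{\mathcal{S}\cup\{\alpha\}}=r_{\mathcal{S}}+1$, then $m(\mathcal{S};G)$ divides $m(\mathcal{S}\cup\{\alpha\};G)$; (4) if $\mathcal{S}\subset\mathcal{T}\subset\mathcal{A}$ and $r_{\mathcal{S}}=r_{\mathcal{T}}$, then $\sum_{\mathcal{S}\subset\mathcal{B}\subset\mathcal{T}}(-1)^{\#\mathcal{B}-\#\mathcal{S}}m(\mathcal{B};G)\ge0$; (5) if $\mathcal{S}\subset\mathcal{T}\subset\mathcal{A}$ and $r_{\mathcal{T}}=r_{\mathcal{S}}+\#(\mathcal{T}\smallsetminus\mathcal{S})$, then $\sum_{\mathcal{S}\subset\mathcal{B}\subset\mathcal{T}}(-1)^{\#\mathcal{T}-\#\mathcal{B}}m(\mathcal{B};G)\ge0$. If moreover $G$ is divisible (multiplication by $k$ is surjective on $G$ for every positive integer $k$), then also: (3) if $\mathcal{S}\subset\mathcal{T}\subset\mathcal{A}$ and $\mathcal{T}=\mathcal{S}\sqcup\mathcal{B}\sqcup\mathcal{C}$ is such that $r_{\mathcal{R}}=r_{\mathcal{S}}+\#(\mathcal{R}\cap\mathcal{B})$ for all $\mathcal{S}\subset\mathcal{R}\subset\mathcal{T}$,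 then $m(\mathcal{S};G)\,m(\mathcal{T};G)=m(\mathcal{S}\sqcup\mathcal{B};G)\,m(\mathcal{S}\sqcup\mathcal{C};G)$.
   Context: $G$ is torsion-wise finite if $G[d]=\{x\in G\mid dx=0\}$ is finite for all $d>0$. Sublists are distinguished by index (sums run over sublists $\mathcal{B}$ with $\mathcal{S}\subset\mathcal{B}\subset\mathcal{T}$). $r_{\mathcal{S}}$ is the rank of $\langle\mathcal{S}\rangle$ and $m(\mathcal{S};G)=\#\mathrm{Hom}((\Gamma/\langle\mathcal{S}\rangle)_{\mathrm{tor}},G)$. *)

theory Defs
  imports "HOL-Algebra.Algebra"
begin

definition fin_gen_group :: "('a,'m) monoid_scheme \<Rightarrow> bool" where
  "fin_gen_group Gm \<longleftrightarrow> (\<exists>Y. finite Y \<and> Y \<subseteq> carrier Gm \<and> generate Gm Y = carrier Gm)"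

definition torsionwise_finite :: "('b,'n) monoid_scheme \<Rightarrow> bool" where
  "torsionwise_finite G \<longleftrightarrow>
     (\<forall>d::nat. d > 0 \<longrightarrow> finite {x \<in> carrier G. x [^]\<^bsub>G\<^esub> d = \<one>\<^bsub>G\<^esub>})"

definition divisible_group :: "('b,'n) monoid_scheme \<Rightarrow> bool" where
  "divisible_group G \<longleftrightarrow>
     (\<forall>k::nat. k > 0 \<longrightarrow> (\<forall>y\<in>carrier G. \<exists>x\<in>carrier G. x [^]\<^bsub>G\<^esub> k = y))"

definition int_independent :: "('a,'m) monoid_scheme \<Rightarrow> 'a set \<Rightarrow> bool" where
  "int_independent Gm Y \<longleftrightarrow>
     (\<forall>c::'a \<Rightarrow> int. finprod Gm (\<lambda>x. x [^]\<^bsub>Gm\<^esub> (c x)) Y = \<one>\<^bsub>Gm\<^esub> \<longrightarrow> (\<forall>x\<in>Y. c x = 0))"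

definition group_rank :: "('a,'m) monoid_scheme \<Rightarrow> 'a set \<Rightarrow> nat" where
  "group_rank Gm H = Max {card Y | Y. finite Y \<and> Y \<subseteq> H \<and> int_independent Gm Y}"

definition span_sub :: "('a,'m) monoid_scheme \<Rightarrow> 'a list \<Rightarrow> nat set \<Rightarrow> 'a set" where
  "span_sub Gm A S = generate Gm ((\<lambda>i. A ! i) ` S)"

definition r_sub :: "('a,'m) monoid_scheme \<Rightarrow> 'a list \<Rightarrow> nat set \<Rightarrow> nat" where
  "r_sub Gm A S = group_rank Gm (span_sub Gm A S)"

definition torsion_subgroup :: "('c,'k) monoid_scheme \<Rightarrow> ('c,'k) monoid_scheme" where
  "torsion_subgroup H = H\<lparr>carrier := {x \<in> carrier H. \<exists>n::nat. n > 0 \<and> x [^]\<^bsub>H\<^esub> n = \<one>\<^bsub>H\<^esub>}\<rparr>"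

text \<open>m(S;G) = #Hom((Gamma/<S>)_tor, G); homomorphisms counted as functions on the carrier.\<close>
definition m_count :: "('a,'m) monoid_scheme \<Rightarrow> 'a list \<Rightarrow> nat set \<Rightarrow> ('b,'n) monoid_scheme \<Rightarrow> nat" where
  "m_count Gm A S G =
     (let T = torsion_subgroup (Gm Mod (span_sub Gm A S))
      in card (hom T G \<inter> extensional (carrier T)))"

end

theory Submission
  imports Defs
begin

text \<open>Let \<open>rad H\<close> be the preimage of the torsion of \<open>\<Gamma>/H\<close>. Then \<open>m(S;G)\<close> counts the homomorphisms
  \<open>rad \<langle>S\<rangle> \<rightarrow> G\<close> vanishing on \<open>S\<close>. If the rank does not grow between \<open>S\<close> and \<open>T\<close>, all these radicals
  coincide: (1) is Lagrange's theorem, and by inclusion-exclusion the sum in (4) counts the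
  homomorphisms vanishing on \<open>S\<close> but on no element of \<open>T - S\<close>.

  If \<open>T - S\<close> is independent modulo \<open>\<langle>S\<rangle>\<close>, the torsion groups of the \<open>\<Gamma>/\<langle>B\<rangle>\<close> embed as subgroups \<open>I(B)\<close>
  of the finite torsion group \<open>Q\<close> of \<open>\<Gamma>/\<langle>T\<rangle>\<close>, with \<open>I(B) \<inter> I(C) = I(B \<inter> C)\<close>. Finite abelian groups satisfy
  \<open>#Hom(X,Y) = #Hom(Y,X)\<close> (split off cyclic factors in both arguments), so
  \<open>m(B;G) = #Hom(G[d], I(B))\<close> with \<open>d = #Q\<close>, which is now monotone in \<open>B\<close>: (2) is again Lagrange's
  theorem and (5) is again inclusion-exclusion. For (3), divisibility of \<open>G\<close> makes the restriction maps from
  \<open>rad \<langle>S \<union> B\<rangle>\<close> to \<open>rad \<langle>S\<rangle>\<close> surjective, and restriction has the same kernel on the homomorphisms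
  vanishing on \<open>S \<union> B\<close> as on those vanishing on \<open>T\<close>.\<close>

section \<open>Groups of homomorphisms\<close>

text \<open>The difficulty of the independent case is variance. As \<open>B\<close> grows, the
  torsion groups grow, but homomorphisms out of them can only be restricted, and restriction need
  not be surjective when \<open>G\<close> is not divisible; the sets being counted do not sit inside
  one another. Exchanging the two arguments of Hom turns them into subsets of one fixed set. The
  exchange needs finite groups on both sides while \<open>G\<close> may be infinite: hence the
  passage to the \<open>d\<close>-torsion, finite by torsion-wise finiteness, with a
  \<open>d\<close> independent of \<open>B\<close>. For divisible \<open>G\<close> the obstacle is
  absent and restriction maps serve directly. All extension problems (retraction onto a cyclic
  subgroup, homomorphisms on a cyclic group, divisible targets) rest on one gluing lemma. Ranks
  enter only through a dichotomy: a new generator inside the radical leaves the rank unchanged, one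
  outside raises it by exactly one. This keeps the argument inside the group, without tensoring with
  the rationals.\<close>

definition homs :: "('a,'m) monoid_scheme \<Rightarrow> ('b,'n) monoid_scheme \<Rightarrow> ('a \<Rightarrow> 'b) set" where
  "homs A G = hom A G \<inter> extensional (carrier A)"

text \<open>Functions are normalised outside the carrier, as in \<open>m_count\<close>, so that
  \<open>card\<close> counts homomorphisms and the group laws are genuine equations between
  functions.\<close>

definition hom_grp :: "('a,'m) monoid_scheme \<Rightarrow> ('b,'n) monoid_scheme \<Rightarrow> ('a \<Rightarrow> 'b) monoid" where
  "hom_grp A G = \<lparr>carrier = homs A G,
     monoid.mult = (\<lambda>f g. \<lambda>x\<in>carrier A. f x \<otimes>\<^bsub>G\<^esub> g x), one = (\<lambda>x\<in>carrier A. \<one>\<^bsub>G\<^esub>)\<rparr>"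

lemma homsI:
  assumes "\<And>x. x \<in> carrier A \<Longrightarrow> f x \<in> carrier G"
    and "\<And>x y. x \<in> carrier A \<Longrightarrow> y \<in> carrier A \<Longrightarrow> f (x \<otimes>\<^bsub>A\<^esub> y) = f x \<otimes>\<^bsub>G\<^esub> f y"
    and "\<And>x. x \<notin> carrier A \<Longrightarrow> f x = undefined"
  shows "f \<in> homs A G"
  using assms by (auto simp: homs_def hom_def extensional_def)

lemma homsD:
  assumes "f \<in> homs A G"
  shows "x \<in> carrier A \<Longrightarrow> f x \<in> carrier G"
    and "x \<in> carrier A \<Longrightarrow> y \<in> carrier A \<Longrightarrow> f (x \<otimes>\<^bsub>A\<^esub> y) = f x \<otimes>\<^bsub>G\<^esub> f y"
    and "x \<notin> carrier A \<Longrightarrow> f x = undefined"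
    and "f \<in> hom A G"
  using assms by (auto simp: homs_def hom_def extensional_def)

lemma homs_eqI:
  assumes "f \<in> homs A G" "g \<in> homs A H" "\<And>x. x \<in> carrier A \<Longrightarrow> f x = g x"
  shows "f = g"
  using assms by (metis ext homsD(3))

lemma comm_group_hom_grp:
  assumes "group A" "comm_group G"
  shows "comm_group (hom_grp A G)"
proof -
  interpret A: group A by fact
  interpret G: comm_group G by fact
  show ?thesis
  proof (rule comm_groupI)
    fix f g assume "f \<in> carrier (hom_grp A G)" "g \<in> carrier (hom_grp A G)"
    then have f: "f \<in> homs A G" and g: "g \<in> homs A G" by (auto simp: hom_grp_def)
    show "f \<otimes>\<^bsub>hom_grp A G\<^esub> g \<in> carrier (hom_grp A G)"
      using homsD[OF f] homsD[OF g] by (auto simp: hom_grp_def G.m_ac intro!: homsI)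
    show "f \<otimes>\<^bsub>hom_grp A G\<^esub> g = g \<otimes>\<^bsub>hom_grp A G\<^esub> f"
      using homsD[OF f] homsD[OF g] by (auto simp: hom_grp_def G.m_comm intro!: restrict_ext)
  next
    show "\<one>\<^bsub>hom_grp A G\<^esub> \<in> carrier (hom_grp A G)"
      by (auto simp: hom_grp_def intro!: homsI)
  next
    fix f g h assume "f \<in> carrier (hom_grp A G)" "g \<in> carrier (hom_grp A G)" "h \<in> carrier (hom_grp A G)"
    then have fgh: "f \<in> homs A G" "g \<in> homs A G" "h \<in> homs A G" by (auto simp: hom_grp_def)
    show "f \<otimes>\<^bsub>hom_grp A G\<^esub> g \<otimes>\<^bsub>hom_grp A G\<^esub> h = f \<otimes>\<^bsub>hom_grp A G\<^esub> (g \<otimes>\<^bsub>hom_grp A G\<^esub> h)"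
      using fgh[THEN homsD(1)] by (auto simp: hom_grp_def G.m_assoc intro!: restrict_ext)
  next
    fix f assume "f \<in> carrier (hom_grp A G)"
    then have f: "f \<in> homs A G" by (auto simp: hom_grp_def)
    show "\<one>\<^bsub>hom_grp A G\<^esub> \<otimes>\<^bsub>hom_grp A G\<^esub> f = f"
      using homsD[OF f] by (auto simp: hom_grp_def fun_eq_iff)
    let ?g = "\<lambda>x\<in>carrier A. inv\<^bsub>G\<^esub> f x"
    have "?g \<in> homs A G"
      using homsD[OF f] by (auto simp: G.inv_mult intro!: homsI)
    moreover have "?g \<otimes>\<^bsub>hom_grp A G\<^esub> f = \<one>\<^bsub>hom_grp A G\<^esub>"
      using homsD[OF f] by (auto simp: hom_grp_def intro!: restrict_ext)
    ultimately show "\<exists>g\<in>carrier (hom_grp A G). g \<otimes>\<^bsub>hom_grp A G\<^esub> f = \<one>\<^bsub>hom_grp A G\<^esub>"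
      by (intro bexI[of _ ?g]) (simp_all add: hom_grp_def)
  qed
qed

lemma inv_hom_grp:
  assumes "group A" "comm_group G" "f \<in> homs A G"
  shows "inv\<^bsub>hom_grp A G\<^esub> f = (\<lambda>x\<in>carrier A. inv\<^bsub>G\<^esub> f x)"
proof -
  interpret A: group A by fact
  interpret G: comm_group G by fact
  interpret H: comm_group "hom_grp A G" using assms by (simp add: comm_group_hom_grp)
  note f = homsD[OF assms(3)]
  show ?thesis
  proof (rule H.inv_equality)
    show "(\<lambda>x\<in>carrier A. inv\<^bsub>G\<^esub> f x) \<otimes>\<^bsub>hom_grp A G\<^esub> f = \<one>\<^bsub>hom_grp A G\<^esub>"
      using f by (auto simp: hom_grp_def intro!: restrict_ext)
    show "f \<in> carrier (hom_grp A G)" using assms by (simp add: hom_grp_def)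
    show "(\<lambda>x\<in>carrier A. inv\<^bsub>G\<^esub> f x) \<in> carrier (hom_grp A G)"
      using f by (auto simp: hom_grp_def G.inv_mult intro!: homsI)
  qed
qed

text \<open>Two instances matter: \<open>I\<close> trivial gives homomorphisms killing
  \<open>H\<close>; \<open>H\<close> the whole carrier gives homomorphisms with values in the
  subgroup \<open>I\<close>.\<close>

lemma subgroup_homs_constrained:
  assumes "group A" "comm_group G" "H \<subseteq> carrier A" "subgroup I G"
  shows "subgroup {f \<in> homs A G. \<forall>h\<in>H. f h \<in> I} (hom_grp A G)"
proof -
  interpret A: group A by fact
  interpret G: comm_group G by fact
  interpret H: comm_group "hom_grp A G" using assms by (simp add: comm_group_hom_grp)
  interpret I: subgroup I G by fact
  show ?thesis
  proof (rule H.subgroupI)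
    show "{f \<in> homs A G. \<forall>h\<in>H. f h \<in> I} \<subseteq> carrier (hom_grp A G)" by (auto simp: hom_grp_def)
    have "\<one>\<^bsub>hom_grp A G\<^esub> \<in> {f \<in> homs A G. \<forall>h\<in>H. f h \<in> I}"
      using assms(3) H.one_closed by (auto simp: hom_grp_def)
    then show "{f \<in> homs A G. \<forall>h\<in>H. f h \<in> I} \<noteq> {}" by blast
  next
    fix f assume f: "f \<in> {f \<in> homs A G. \<forall>h\<in>H. f h \<in> I}"
    then have "inv\<^bsub>hom_grp A G\<^esub> f \<in> homs A G"
      using H.inv_closed[of f] by (auto simp: hom_grp_def)
    then show "inv\<^bsub>hom_grp A G\<^esub> f \<in> {f \<in> homs A G. \<forall>h\<in>H. f h \<in> I}"
      using f assms by (auto simp: inv_hom_grp subset_iff)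
  next
    fix f g assume fg: "f \<in> {f \<in> homs A G. \<forall>h\<in>H. f h \<in> I}" "g \<in> {f \<in> homs A G. \<forall>h\<in>H. f h \<in> I}"
    then have "f \<otimes>\<^bsub>hom_grp A G\<^esub> g \<in> homs A G"
      using H.m_closed[of f g] by (auto simp: hom_grp_def)
    then show "f \<otimes>\<^bsub>hom_grp A G\<^esub> g \<in> {f \<in> homs A G. \<forall>h\<in>H. f h \<in> I}"
      using fg assms(3) by (auto simp: hom_grp_def subset_iff)
  qed
qed

lemma (in group) card_subgroup_dvd:
  assumes "subgroup H G"
  shows "card H dvd card (carrier G)"
  by (metis assms dvd_triv_right lagrange order_def)

lemma card_homs_constrained_dvd:
  assumes "group A" "comm_group G" "H \<subseteq> carrier A" "subgroup I G"
  shows "card {f \<in> homs A G. \<forall>h\<in>H. f h \<in> I} dvd card (homs A G)"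
  using group.card_subgroup_dvd[OF comm_group.axioms(2)[OF comm_group_hom_grp] subgroup_homs_constrained]
    assms by (fastforce simp: hom_grp_def)

text \<open>First isomorphism theorem and Lagrange. For an infinite carrier both sides are 0, since
  image or kernel is then infinite and has \<open>card\<close> 0.\<close>

lemma (in group_hom) card_image_times_kernel:
  "card (h ` carrier G) * card (kernel G H h) = card (carrier G)"
proof -
  interpret K: group_hom G "H\<lparr>carrier := h ` carrier G\<rparr>" h
    using H.subgroup_imp_group[OF img_is_subgroup] homh
    by (auto simp: group_hom_def group_hom_axioms_def hom_def)
  have ker: "kernel G (H\<lparr>carrier := h ` carrier G\<rparr>) h = kernel G H h" by (simp add: kernel_def)
  have "card (carrier (G Mod kernel G H h)) = card (h ` carrier G)"
    using K.FactGroup_iso_set[unfolded ker] by (auto simp: iso_def dest: bij_betw_same_card)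
  then show ?thesis
    using G.lagrange[OF subgroup_kernel] by (simp add: FactGroup_def order_def)
qed

section \<open>Extension of homomorphisms\<close>

lemma (in comm_group) subgroup_imp_comm_group:
  assumes "subgroup H G"
  shows "comm_group (G\<lparr>carrier := H\<rparr>)"
  using group.group_comm_groupI[OF subgroup_imp_group[OF assms]] subgroup.mem_carrier[OF assms] m_comm
  by simp

lemma (in group) subgroup_nat_pow_closed:
  "subgroup H G \<Longrightarrow> h \<in> H \<Longrightarrow> h [^] (n::nat) \<in> H"
  using subgroup_int_pow_closed[of H h "int n"] by (simp add: int_pow_int)

lemma (in group) hom_subgroup_inv:
  assumes "group K" "subgroup H G" "f \<in> hom (G\<lparr>carrier := H\<rparr>) K" "x \<in> H"
  shows "f (inv x) = inv\<^bsub>K\<^esub> f x"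
proof -
  interpret group_hom "G\<lparr>carrier := H\<rparr>" K f
    using assms by (simp add: group_hom_def group_hom_axioms_def subgroup_imp_group)
  show ?thesis using hom_inv[of x] assms by simp
qed

text \<open>The exponents that carry \<open>a\<close> into \<open>D\<close> form an ideal of the
  integers, generated by its least positive element.\<close>

lemma (in group) least_pow_dvd:
  assumes D: "subgroup D G" and a: "a \<in> carrier G" and k: "0 < k" "a [^] (k::nat) \<in> D"
    and min: "\<forall>j. 0 < j \<and> j < k \<longrightarrow> a [^] j \<notin> D" and z: "a [^] (z::int) \<in> D"
  shows "int k dvd z"
proof -
  interpret D: subgroup D G by fact
  define q where "q = z div int k"
  define j where "j = nat (z mod int k)"
  have j: "j < k" "z = int k * q + int j" using k by (auto simp: q_def j_def nat_less_iff)
  have pk: "(a [^] k) [^] q = a [^] (int k * q)"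
    using int_pow_pow[OF a, of "int k" q] by (simp add: int_pow_int)
  have "a [^] z = (a [^] k) [^] q \<otimes> a [^] int j" using a by (simp add: pk j(2) int_pow_mult)
  then have eqj: "a [^] int j = inv ((a [^] k) [^] q) \<otimes> a [^] z"
    by (subst inv_solve_left) (use a in auto)
  have "a [^] int j \<in> D"
    unfolding eqj by (intro D.m_closed D.m_inv_closed subgroup_int_pow_closed[OF D k(2)] z)
  then have "a [^] j \<in> D" by (simp add: int_pow_int)
  then have "j = 0" using min j(1) by (meson neq0_conv)
  then show ?thesis using j by simp
qed

text \<open>Sending \<open>h \<otimes> \<psi> n\<close> to the product of \<open>f h\<close> and
  \<open>\<phi> n\<close> is consistent precisely because of \<open>agree\<close>. A group
  \<open>N\<close> with a map into \<open>G\<close>, rather than a second subgroup, covers both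
  uses: the integers, mapped by powers of one element, and a subgroup on which the extension is
  prescribed to be trivial.\<close>

lemma (in comm_group) hom_glue:
  assumes K: "comm_group K" and H: "subgroup H G" and f: "f \<in> hom (G\<lparr>carrier := H\<rparr>) K"
    and N: "group N" and \<psi>: "\<psi> \<in> hom N G" and \<phi>: "\<phi> \<in> hom N K"
    and agree: "\<forall>n\<in>carrier N. \<psi> n \<in> H \<longrightarrow> f (\<psi> n) = \<phi> n"
  shows "\<exists>D F. subgroup D G \<and> H \<subseteq> D \<and> \<psi> ` carrier N \<subseteq> D \<and> F \<in> hom (G\<lparr>carrier := D\<rparr>) K
    \<and> (\<forall>h\<in>H. F h = f h) \<and> (\<forall>n\<in>carrier N. F (\<psi> n) = \<phi> n)"
proof -
  interpret K: comm_group K by fact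
  interpret N: group N by fact
  interpret H: subgroup H G by fact
  interpret \<psi>: group_hom N G \<psi> using \<psi> by (simp add: group_hom_def group_hom_axioms_def)
  interpret \<phi>: group_hom N K \<phi> using \<phi> by (simp add: group_hom_def group_hom_axioms_def)
  have fc: "f h \<in> carrier K" if "h \<in> H" for h using f that by (auto simp: hom_def)
  have fm: "f (h \<otimes> h') = f h \<otimes>\<^bsub>K\<^esub> f h'" if "h \<in> H" "h' \<in> H" for h h'
    using f that by (auto simp: hom_def)
  have f1: "f \<one> = \<one>\<^bsub>K\<^esub>" using bspec[OF agree N.one_closed] by simp
  define F where "F x = (SOME y. \<exists>h\<in>H. \<exists>n\<in>carrier N. x = h \<otimes> \<psi> n \<and> y = f h \<otimes>\<^bsub>K\<^esub> \<phi> n)" for x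
  have F: "F (h \<otimes> \<psi> n) = f h \<otimes>\<^bsub>K\<^esub> \<phi> n" if h: "h \<in> H" and n: "n \<in> carrier N" for h n
  proof -
    \<comment> \<open>Two factorizations of the same element differ by some \<open>\<psi> m\<close>
      lying in \<open>H\<close>, and that is where \<open>agree\<close> applies.\<close>
    have uniq: "f h' \<otimes>\<^bsub>K\<^esub> \<phi> n' = f h \<otimes>\<^bsub>K\<^esub> \<phi> n"
      if h': "h' \<in> H" and n': "n' \<in> carrier N" and eq: "h \<otimes> \<psi> n = h' \<otimes> \<psi> n'" for h' n'
    proof -
      have eq2: "inv h' \<otimes> h = \<psi> (n' \<otimes>\<^bsub>N\<^esub> inv\<^bsub>N\<^esub> n)"
      proof -
        have "inv h' \<otimes> h = inv h' \<otimes> (h \<otimes> \<psi> n) \<otimes> inv (\<psi> n)"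
          using h h' n by (simp add: m_assoc)
        also have "\<dots> = \<psi> n' \<otimes> inv (\<psi> n)"
          unfolding eq using h' n' n by (simp flip: m_assoc)
        finally show ?thesis using n n' by simp
      qed
      have "f (inv h' \<otimes> h) = \<phi> (n' \<otimes>\<^bsub>N\<^esub> inv\<^bsub>N\<^esub> n)"
        using bspec[OF agree, of "n' \<otimes>\<^bsub>N\<^esub> inv\<^bsub>N\<^esub> n"] h h' n n' eq2
        by (metis H.m_closed H.m_inv_closed N.inv_closed N.m_closed)
      then have "inv\<^bsub>K\<^esub> f h' \<otimes>\<^bsub>K\<^esub> f h = \<phi> n' \<otimes>\<^bsub>K\<^esub> inv\<^bsub>K\<^esub> \<phi> n"
        using h h' n n' by (simp add: fm hom_subgroup_inv[OF K.is_group H f])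
      then have "f h = f h' \<otimes>\<^bsub>K\<^esub> (\<phi> n' \<otimes>\<^bsub>K\<^esub> inv\<^bsub>K\<^esub> \<phi> n)"
        using h h' n n' fc by (metis K.inv_solve_left' K.inv_closed K.m_closed \<phi>.hom_closed)
      then show ?thesis
        using h h' n n' fc by (simp add: K.m_assoc)
    qed
    show ?thesis unfolding F_def
      by (rule some_equality) (use uniq h n in blast)+
  qed
  show ?thesis
  proof (intro exI[of _ "H <#> \<psi> ` carrier N"] exI[of _ F] conjI ballI)
    show "subgroup (H <#> \<psi> ` carrier N) G" using H \<psi>.img_is_subgroup by (rule mult_subgroups)
    have "h \<in> H <#> \<psi> ` carrier N" if "h \<in> H" for h
      using that by (auto simp: set_mult_def intro!: bexI[of _ h] bexI[of _ "\<one>\<^bsub>N\<^esub>"])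
    then show "H \<subseteq> H <#> \<psi> ` carrier N" by blast
    have "\<psi> n \<in> H <#> \<psi> ` carrier N" if "n \<in> carrier N" for n
      using that by (auto simp: set_mult_def intro!: bexI[of _ \<one>] bexI[of _ n])
    then show "\<psi> ` carrier N \<subseteq> H <#> \<psi> ` carrier N" by blast
    show "F h = f h" if "h \<in> H" for h
      using F[OF that N.one_closed] fc that by simp
    show "F (\<psi> n) = \<phi> n" if "n \<in> carrier N" for n
      using F[OF H.one_closed that] fc that f1 by simp
    show "F \<in> hom (G\<lparr>carrier := H <#> \<psi> ` carrier N\<rparr>) K"
    proof (rule homI)
      fix x assume "x \<in> carrier (G\<lparr>carrier := H <#> \<psi> ` carrier N\<rparr>)"
      then show "F x \<in> carrier K" by (auto simp: set_mult_def F fc)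
    next
      fix x y assume "x \<in> carrier (G\<lparr>carrier := H <#> \<psi> ` carrier N\<rparr>)"
        "y \<in> carrier (G\<lparr>carrier := H <#> \<psi> ` carrier N\<rparr>)"
      then obtain h n h' n' where hn: "h \<in> H" "n \<in> carrier N" "x = h \<otimes> \<psi> n"
        "h' \<in> H" "n' \<in> carrier N" "y = h' \<otimes> \<psi> n'" by (auto simp: set_mult_def)
      have xy: "x \<otimes> y = (h \<otimes> h') \<otimes> \<psi> (n \<otimes>\<^bsub>N\<^esub> n')" using hn by (simp add: m_ac)
      have "F (x \<otimes> y) = f (h \<otimes> h') \<otimes>\<^bsub>K\<^esub> \<phi> (n \<otimes>\<^bsub>N\<^esub> n')"
        unfolding xy by (rule F) (use hn in auto)
      then show "F (x \<otimes>\<^bsub>G\<lparr>carrier := H <#> \<psi> ` carrier N\<rparr>\<^esub> y) = F x \<otimes>\<^bsub>K\<^esub> F y"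
        using hn fc by (simp add: F fm K.m_ac)
    qed
  qed
qed

text \<open>If \<open>k\<close> is the least positive exponent with \<open>a [^] k\<close> in
  \<open>H\<close>, the image of \<open>a\<close> must be a \<open>k\<close>-th root of
  \<open>f (a [^] k)\<close>, and any such root works. Roots are demanded for this minimal
  \<open>k\<close> only: in a cyclic target they exist because the minimal \<open>k\<close> divides
  the exponent of the group.\<close>

lemma (in comm_group) hom_extend_one:
  assumes K: "comm_group K" and H: "subgroup H G" and f: "f \<in> hom (G\<lparr>carrier := H\<rparr>) K"
    and a: "a \<in> carrier G"
    and root: "\<forall>k::nat. 0 < k \<longrightarrow> a [^] k \<in> H \<longrightarrow> (\<forall>j. 0 < j \<and> j < k \<longrightarrow> a [^] j \<notin> H)
      \<longrightarrow> (\<exists>g\<in>carrier K. g [^]\<^bsub>K\<^esub> k = f (a [^] k))"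
  shows "\<exists>D F. subgroup D G \<and> H \<subseteq> D \<and> a \<in> D \<and> F \<in> hom (G\<lparr>carrier := D\<rparr>) K \<and> (\<forall>h\<in>H. F h = f h)"
proof -
  interpret K: comm_group K by fact
  interpret H: subgroup H G by fact
  have grp: "group (G\<lparr>carrier := H\<rparr>)" using H by (rule subgroup_imp_group)
  have "\<exists>g\<in>carrier K. \<forall>z::int. a [^] z \<in> H \<longrightarrow> f (a [^] z) = g [^]\<^bsub>K\<^esub> z"
  proof (cases "\<exists>k::nat. 0 < k \<and> a [^] k \<in> H")
    case True
    define k where "k = (LEAST k::nat. 0 < k \<and> a [^] k \<in> H)"
    have k: "0 < k" "a [^] k \<in> H" using LeastI_ex[OF True] by (simp_all add: k_def)
    have min: "\<forall>j. 0 < j \<and> j < k \<longrightarrow> a [^] j \<notin> H" using not_less_Least by (auto simp: k_def)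
    from root k min obtain g where g: "g \<in> carrier K" "g [^]\<^bsub>K\<^esub> k = f (a [^] k)" by blast
    have "f (a [^] z) = g [^]\<^bsub>K\<^esub> z" if z: "a [^] z \<in> H" for z :: int
    proof -
      obtain q where zq: "z = int k * q"
        using least_pow_dvd[OF H a k(1,2) min z] by blast
      have pk: "(a [^] k) [^] q = a [^] (int k * q)" using int_pow_pow[OF a, of "int k" q] by (simp add: int_pow_int)
      have "a [^] z = (a [^] k) [^] q" by (simp add: pk zq)
      also have "f \<dots> = f (a [^] k) [^]\<^bsub>K\<^esub> q"
        using hom_int_pow[OF f _ grp K.is_group, of "a [^] k" q] k(2) int_pow_consistent[OF H k(2)] by simp
      also have "\<dots> = g [^]\<^bsub>K\<^esub> z" using K.int_pow_pow[OF g(1), of "int k" q] by (simp add: int_pow_int zq flip: g(2))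
      finally show ?thesis .
    qed
    with g show ?thesis by blast
  next
    case False
    \<comment> \<open>Only the zero exponent returns to \<open>H\<close>, so every image of
      \<open>a\<close> is consistent; the unit is chosen.\<close>
    have "z = 0" if z: "a [^] z \<in> H" for z :: int
    proof (rule ccontr)
      assume "z \<noteq> 0"
      obtain n where n: "z = int n \<or> z = - int n" by (metis int_cases2)
      then have "a [^] n \<in> H"
        using z H.m_inv_closed[OF z] inv_inv[of "a [^] n"] a by (metis int_pow_int int_pow_neg_int nat_pow_closed)
      moreover have "0 < n" using n \<open>z \<noteq> 0\<close> by auto
      ultimately show False using False by blast
    qed
    moreover have "f \<one> = \<one>\<^bsub>K\<^esub>" using hom_one[OF f grp K.is_group] by simp
    ultimately have "\<forall>z::int. a [^] z \<in> H \<longrightarrow> f (a [^] z) = \<one>\<^bsub>K\<^esub> [^]\<^bsub>K\<^esub> z" by (metis int_pow_0)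
    then show ?thesis by blast
  qed
  then obtain g where g: "g \<in> carrier K" "\<And>z::int. a [^] z \<in> H \<Longrightarrow> f (a [^] z) = g [^]\<^bsub>K\<^esub> z" by blast
  have "\<forall>n::int\<in>carrier integer_group. a [^] n \<in> H \<longrightarrow> f (a [^] n) = g [^]\<^bsub>K\<^esub> n" using g(2) by simp
  from hom_glue[OF K H f group_integer_group hom_integer_group_pow[OF a] K.hom_integer_group_pow[OF g(1)] this,
      unfolded carrier_integer_group]
  obtain D F where DF: "subgroup D G" "H \<subseteq> D" "([^]) a ` (UNIV :: int set) \<subseteq> D"
     "F \<in> hom (G\<lparr>carrier := D\<rparr>) K" "\<forall>h\<in>H. F h = f h"
    by (elim exE conjE) (rule that)
  have "a [^] (1::int) \<in> D" using DF(3) by auto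
  then have "a \<in> D" using a by simp
  with DF show ?thesis by blast
qed

text \<open>The root condition quantifies over all intermediate \<open>D\<close> and
  \<open>F\<close>, since the induction over \<open>Y\<close> has to extend each partial extension
  again.\<close>

lemma (in comm_group) hom_extend_finite:
  assumes K: "comm_group K" and "subgroup H G" and "f \<in> hom (G\<lparr>carrier := H\<rparr>) K"
    and "finite Y" "Y \<subseteq> carrier G"
    and root: "\<And>D F a k. subgroup D G \<Longrightarrow> H \<subseteq> D \<Longrightarrow> F \<in> hom (G\<lparr>carrier := D\<rparr>) K \<Longrightarrow> a \<in> carrier G
      \<Longrightarrow> 0 < k \<Longrightarrow> a [^] (k::nat) \<in> D \<Longrightarrow> \<forall>j. 0 < j \<and> j < k \<longrightarrow> a [^] j \<notin> D
      \<Longrightarrow> \<exists>g\<in>carrier K. g [^]\<^bsub>K\<^esub> k = F (a [^] k)"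
  shows "\<exists>D F. subgroup D G \<and> H \<subseteq> D \<and> Y \<subseteq> D \<and> F \<in> hom (G\<lparr>carrier := D\<rparr>) K \<and> (\<forall>h\<in>H. F h = f h)"
  using assms(4,5)
proof (induction Y)
  case empty
  then show ?case using assms(2,3) by blast
next
  case (insert a Y)
  then obtain D F where DF: "subgroup D G" "H \<subseteq> D" "Y \<subseteq> D" "F \<in> hom (G\<lparr>carrier := D\<rparr>) K" "\<forall>h\<in>H. F h = f h"
    by auto
  from insert have a: "a \<in> carrier G" by simp
  obtain D' F' where "subgroup D' G" "D \<subseteq> D'" "a \<in> D'" "F' \<in> hom (G\<lparr>carrier := D'\<rparr>) K"
    "\<forall>h\<in>D. F' h = F h"
    using hom_extend_one[OF K DF(1,4) a] root[OF DF(1,2,4) a] by blast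
  with DF show ?case by (intro exI[of _ D'] exI[of _ F']) auto
qed

section \<open>Symmetry of the number of homomorphisms between finite abelian groups\<close>

text \<open>Take \<open>c\<close> of maximal order. If a prime \<open>p\<close> occurred to a higher
  power in \<open>ord x\<close> than in \<open>ord c\<close>, the \<open>p\<close>-part of
  \<open>x\<close> times the part of \<open>c\<close> prime to \<open>p\<close> would have order
  larger than \<open>ord c\<close>.\<close>

lemma (in comm_group) exists_ord_eq_exponent:
  assumes fin: "finite (carrier G)"
  shows "\<exists>c\<in>carrier G. \<forall>x\<in>carrier G. x [^] ord c = \<one>"
proof -
  have "Max (ord ` carrier G) \<in> ord ` carrier G" using fin by (intro Max_in) auto
  then obtain c where c: "c \<in> carrier G" "Max (ord ` carrier G) = ord c" by auto
  have le: "ord x \<le> ord c" if "x \<in> carrier G" for x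
    using that fin by (simp flip: c(2))
  have pos: "0 < ord x" if "x \<in> carrier G" for x using ord_ge_1[OF fin that] by simp
  have "ord x dvd ord c" if x: "x \<in> carrier G" for x
  proof (rule multiplicity_le_imp_dvd)
    show "ord x \<noteq> 0" using pos[OF x] by simp
    fix p :: nat assume p: "Factorial_Ring.prime p"
    show "multiplicity p (ord x) \<le> multiplicity p (ord c)"
    proof (rule ccontr)
      define e where "e = multiplicity p (ord x)"
      define f where "f = multiplicity p (ord c)"
      assume "\<not> multiplicity p (ord x) \<le> multiplicity p (ord c)"
      then have fe: "f < e" by (simp add: e_def f_def)
      have e: "p ^ e dvd ord x" and f: "p ^ f dvd ord c" by (simp_all add: e_def f_def multiplicity_dvd)
      define k where "k = ord x div p ^ e"
      have k: "ord x = k * p ^ e" using e by (simp add: k_def)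
      define n where "n = ord c div p ^ f"
      have n: "ord c = n * p ^ f" using f by (simp add: n_def)
      have "\<not> p dvd n"
        using multiplicity_decompose[of "ord c" p] pos[OF c(1)] prime_gt_1_nat[OF p] by (simp add: n_def f_def)
      then have cop: "coprime (p ^ e) n" using p by (simp add: prime_imp_coprime)
      define y where "y = x [^] k"
      define z where "z = c [^] (p ^ f)"
      have yz: "y \<in> carrier G" "z \<in> carrier G" using x c by (simp_all add: y_def z_def)
      have ord_y: "ord y = p ^ e" and ord_z: "ord z = n"
        unfolding y_def z_def using x c k n pos[OF x] pos[OF c(1)] by (subst ord_pow; auto)+
      define N where "N = ord (y \<otimes> z)"
      have N: "y [^] N \<otimes> z [^] N = \<one>"
        unfolding N_def using yz by (simp flip: nat_pow_distrib)
      have "y [^] (N * n) \<otimes> z [^] (N * n) = \<one>"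
        using N yz by (metis nat_pow_closed nat_pow_distrib nat_pow_one nat_pow_pow)
      moreover have "z [^] (N * n) = \<one>" using yz ord_z by (simp add: pow_eq_id)
      ultimately have "p ^ e dvd N * n" using yz by (simp add: pow_eq_id ord_y)
      then have d1: "p ^ e dvd N" using cop by (simp add: coprime_dvd_mult_left_iff)
      have "y [^] (N * p ^ e) \<otimes> z [^] (N * p ^ e) = \<one>"
        using N yz by (metis nat_pow_closed nat_pow_distrib nat_pow_one nat_pow_pow)
      moreover have "y [^] (N * p ^ e) = \<one>" using yz ord_y by (simp add: pow_eq_id)
      ultimately have "n dvd N * p ^ e" using yz by (simp add: pow_eq_id ord_z)
      then have d2: "n dvd N" using cop by (simp add: coprime_commute coprime_dvd_mult_left_iff)
      from d1 d2 cop have "p ^ e * n dvd N" by (simp add: divides_mult)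
      then have "p ^ e * n \<le> ord c"
        using le[of "y \<otimes> z"] pos[of "y \<otimes> z"] yz by (metis N_def dvd_imp_le le_trans m_closed)
      moreover have "p ^ f * n < p ^ e * n"
        using power_strict_increasing[OF fe prime_gt_1_nat[OF p]] pos[OF c(1)] n by simp
      ultimately show False using n by (simp add: mult.commute)
    qed
  qed
  then show ?thesis using c(1) by (intro bexI[of _ c]) (simp_all add: pow_eq_id)
qed

lemma (in group) int_pow_eq_one_dvd:
  assumes "x \<in> carrier G" "x [^] (n::nat) = \<one>" "int n dvd z"
  shows "x [^] z = \<one>"
proof -
  obtain q where "z = int n * q" using assms(3) by blast
  then have "x [^] z = (x [^] int n) [^] q" using assms(1) by (simp add: int_pow_pow)
  then show ?thesis using assms(2) by (simp add: int_pow_int)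
qed

text \<open>The cyclic group of order \<open>n\<close> is injective among groups of exponent \<open>n\<close>,
  so the identity of a cyclic subgroup of maximal order extends to a retraction.\<close>
lemma (in comm_group) cyclic_retraction:
  assumes fin: "finite (carrier G)" and c: "c \<in> carrier G" and exp: "\<forall>x\<in>carrier G. x [^] ord c = \<one>"
  shows "\<exists>r\<in>hom G G. r ` carrier G = range (\<lambda>z::int. c [^] z) \<and> (\<forall>z::int. r (c [^] z) = c [^] z)"
proof -
  define C where "C = range (\<lambda>z::int. c [^] z)"
  have C: "subgroup C G" unfolding C_def using c by (rule subgroup_of_powers)
  let ?K = "G\<lparr>carrier := C\<rparr>"
  have K: "comm_group ?K" using C by (rule subgroup_imp_comm_group)
  interpret K: comm_group ?K by fact
  have "\<exists>D F. subgroup D G \<and> C \<subseteq> D \<and> carrier G \<subseteq> D \<and> F \<in> hom (G\<lparr>carrier := D\<rparr>) ?K \<and> (\<forall>h\<in>C. F h = h)"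
  proof (rule hom_extend_finite[OF K C _ fin subset_refl])
    show "(\<lambda>x. x) \<in> hom ?K ?K" by (simp add: hom_def)
    fix D F a and k :: nat
    assume D: "subgroup D G" and F: "F \<in> hom (G\<lparr>carrier := D\<rparr>) ?K" and a: "a \<in> carrier G"
      and k: "0 < k" "a [^] k \<in> D" "\<forall>j. 0 < j \<and> j < k \<longrightarrow> a [^] j \<notin> D"
    have "a [^] int (ord c) \<in> D" using exp a subgroup.one_closed[OF D] by (simp add: int_pow_int)
    then have "int k dvd int (ord c)" by (rule least_pow_dvd[OF D a k])
    then have "k dvd ord c" by simp
    then obtain l where l: "ord c = k * l" by blast
    have "0 < ord c" using ord_ge_1[OF fin c] by simp
    then have l0: "0 < l" using l by simp
    have gD: "group (G\<lparr>carrier := D\<rparr>)" using D by (rule subgroup_imp_group)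
    have "F (a [^] k) \<in> C" using F k by (auto simp: hom_def)
    then obtain j :: int where j: "F (a [^] k) = c [^] j" by (auto simp: C_def)
    \<comment> \<open>Since \<open>k * l = ord c\<close>, the image \<open>c [^] j\<close> of
      \<open>a [^] k\<close> is killed by \<open>l\<close>. This forces \<open>k\<close> to divide
      \<open>j\<close>, and \<open>c [^] (j div k)\<close> is the required root.\<close>
    have "F ((a [^] k) [^] l) = F (a [^] k) [^] l"
      using hom_nat_pow[OF F _ gD K.is_group, of "a [^] k" l] k(2) by (simp flip: nat_pow_consistent)
    moreover have "(a [^] k) [^] l = \<one>" using a exp l by (simp add: nat_pow_pow)
    moreover have "F \<one> = \<one>" using hom_one[OF F gD K.is_group] by simp
    ultimately have "c [^] (j * int l) = \<one>" using int_pow_pow[OF c, of j "int l"] j by (simp add: int_pow_int)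
    then have "int k * int l dvd j * int l" using c l by (simp add: int_pow_eq_id)
    then have "int k dvd j" using l0 by simp
    then obtain i where i: "j = i * int k" by (metis dvdE mult.commute)
    have "(c [^] i) [^]\<^bsub>?K\<^esub> k = F (a [^] k)"
      using int_pow_pow[OF c, of i "int k"] j i by (simp add: int_pow_int flip: nat_pow_consistent)
    then show "\<exists>g\<in>carrier ?K. g [^]\<^bsub>?K\<^esub> k = F (a [^] k)" by (auto simp: C_def)
  qed
  then obtain D F where DF: "subgroup D G" "carrier G \<subseteq> D" "F \<in> hom (G\<lparr>carrier := D\<rparr>) ?K" "\<forall>h\<in>C. F h = h"
    by blast
  then have "D = carrier G" using subgroup.subset by blast
  then have F: "F \<in> hom G ?K" using DF by simp
  have CG: "C \<subseteq> carrier G" using C subgroup.subset by blast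
  have "F \<in> hom G G" using F CG by (auto simp: hom_def)
  moreover have "F ` carrier G = C"
  proof
    show "F ` carrier G \<subseteq> C" using F by (auto simp: hom_def)
    show "C \<subseteq> F ` carrier G"
    proof
      fix x assume "x \<in> C"
      then show "x \<in> F ` carrier G" using DF(4) CG by (intro image_eqI[of _ _ x]) auto
    qed
  qed
  ultimately show ?thesis using DF(4) by (auto simp: C_def)
qed

text \<open>A direct decomposition is encoded by an idempotent endomorphism \<open>r\<close>, with
  factors its image and its kernel. Both are carriers inside the same record, so \<open>P\<close>
  can be applied to them without changing types. The \<open>r\<close> used in the proof retracts
  onto a cyclic subgroup of maximal order.\<close>

lemma finite_comm_group_induct [consumes 2, case_names cyclic split]:
  assumes "comm_group A" "finite (carrier A)"
    and cyclic: "\<And>A c. comm_group A \<Longrightarrow> finite (carrier A) \<Longrightarrow> c \<in> carrier A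
      \<Longrightarrow> carrier A = range (\<lambda>z::int. c [^]\<^bsub>A\<^esub> z) \<Longrightarrow> P A"
    and split: "\<And>A r. comm_group A \<Longrightarrow> finite (carrier A) \<Longrightarrow> r \<in> hom A A
      \<Longrightarrow> (\<And>x. x \<in> carrier A \<Longrightarrow> r (r x) = r x)
      \<Longrightarrow> P (A\<lparr>carrier := r ` carrier A\<rparr>) \<Longrightarrow> P (A\<lparr>carrier := kernel A A r\<rparr>) \<Longrightarrow> P A"
  shows "P A"
  using assms(1,2)
proof (induction "card (carrier A)" arbitrary: A rule: less_induct)
  case less
  interpret A: comm_group A by fact
  obtain c where c: "c \<in> carrier A" "\<forall>x\<in>carrier A. x [^]\<^bsub>A\<^esub> A.ord c = \<one>\<^bsub>A\<^esub>"
    using A.exists_ord_eq_exponent less.prems(2) by blast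
  obtain r where r: "r \<in> hom A A" "r ` carrier A = range (\<lambda>z::int. c [^]\<^bsub>A\<^esub> z)"
    "\<forall>z::int. r (c [^]\<^bsub>A\<^esub> z) = c [^]\<^bsub>A\<^esub> z"
    using A.cyclic_retraction[OF less.prems(2) c] by blast
  interpret r: group_hom A A r using r(1) by (simp add: group_hom_def group_hom_axioms_def)
  show ?case
  proof (cases "c = \<one>\<^bsub>A\<^esub>")
    case True
    \<comment> \<open>The order of \<open>c\<close> is 1 and kills everything. The trivial group
      counts as cyclic here, because the kernel of \<open>r\<close> would not be a smaller
      group.\<close>
    then have "carrier A = {\<one>\<^bsub>A\<^esub>}" using c by auto
    then show ?thesis using cyclic[OF less.prems, of "\<one>\<^bsub>A\<^esub>"] by auto
  next
    case False
    have sub: "subgroup (r ` carrier A) A" by (rule r.img_is_subgroup)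
    have cr: "c \<in> r ` carrier A" unfolding r(2) using range_eqI[of c "\<lambda>z::int. c [^]\<^bsub>A\<^esub> z" 1] A.int_pow_1[OF c(1)] by simp
    have rr: "r (r x) = r x" if "x \<in> carrier A" for x using r that by (metis image_iff rangeE)
    have "P (A\<lparr>carrier := r ` carrier A\<rparr>)"
    proof (rule cyclic)
      show "comm_group (A\<lparr>carrier := r ` carrier A\<rparr>)" using sub by (rule A.subgroup_imp_comm_group)
      show "c \<in> carrier (A\<lparr>carrier := r ` carrier A\<rparr>)" using cr by simp
      show "carrier (A\<lparr>carrier := r ` carrier A\<rparr>) = range (\<lambda>z::int. c [^]\<^bsub>A\<lparr>carrier := r ` carrier A\<rparr>\<^esub> z)"
        unfolding A.int_pow_consistent[OF sub cr, symmetric] using r(2) by simp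
    qed (use less.prems in simp)
    moreover have "P (A\<lparr>carrier := kernel A A r\<rparr>)"
    proof (rule less.hyps)
      have "r c = c" using r(3)[rule_format, of 1] c by simp
      then have "c \<notin> kernel A A r" using False by (simp add: kernel_def)
      then have "kernel A A r \<subset> carrier A" using c by (auto simp: kernel_def)
      then show "card (carrier (A\<lparr>carrier := kernel A A r\<rparr>)) < card (carrier A)"
        using less.prems(2) by (simp add: psubset_card_mono)
      show "comm_group (A\<lparr>carrier := kernel A A r\<rparr>)"
        using r.subgroup_kernel by (rule A.subgroup_imp_comm_group)
      show "finite (carrier (A\<lparr>carrier := kernel A A r\<rparr>))"
        using less.prems(2) by (simp add: kernel_def)
    qed
    ultimately show ?thesis using split[OF less.prems r(1)] rr by blast
  qed
qed

text \<open>Every \<open>x\<close> is the product of \<open>r x\<close> in the image and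
  \<open>x \<otimes> inv (r x)\<close> in the kernel. A homomorphism is therefore its pair of
  restrictions, and any pair recombines because \<open>G\<close> is commutative.\<close>

lemma card_homs_from_split:
  assumes A: "comm_group A" and G: "comm_group G" and r: "r \<in> hom A A"
    and rr: "\<And>x. x \<in> carrier A \<Longrightarrow> r (r x) = r x"
  shows "card (homs A G) = card (homs (A\<lparr>carrier := r ` carrier A\<rparr>) G) * card (homs (A\<lparr>carrier := kernel A A r\<rparr>) G)"
proof -
  interpret A: comm_group A by fact
  interpret G: comm_group G by fact
  interpret r: group_hom A A r using r by (simp add: group_hom_def group_hom_axioms_def)
  let ?C = "r ` carrier A" and ?K = "kernel A A r"
  have sub: "?C \<subseteq> carrier A" "?K \<subseteq> carrier A" by (auto simp: kernel_def)
  have sK: "x \<otimes>\<^bsub>A\<^esub> inv\<^bsub>A\<^esub> r x \<in> ?K" if "x \<in> carrier A" for x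
    using that by (simp add: kernel_def rr)
  have split: "r x \<otimes>\<^bsub>A\<^esub> (x \<otimes>\<^bsub>A\<^esub> inv\<^bsub>A\<^esub> r x) = x" if "x \<in> carrier A" for x
    using that by (simp add: A.m_lcomm)
  let ?to = "\<lambda>f. (restrict f ?C, restrict f ?K)"
  let ?from = "\<lambda>(f, g). \<lambda>x\<in>carrier A. f (r x) \<otimes>\<^bsub>G\<^esub> g (x \<otimes>\<^bsub>A\<^esub> inv\<^bsub>A\<^esub> r x)"
  have "bij_betw ?to (homs A G) (homs (A\<lparr>carrier := ?C\<rparr>) G \<times> homs (A\<lparr>carrier := ?K\<rparr>) G)"
  proof (rule bij_betw_byWitness[where f' = ?from])
    show "\<forall>f\<in>homs A G. ?from (?to f) = f"
    proof
      fix f assume f: "f \<in> homs A G"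
      show "?from (?to f) = f"
      proof
        fix x show "?from (?to f) x = f x"
          using homsD(3)[OF f] sK[of x] split[of x] homsD(2)[OF f, of "r x" "x \<otimes>\<^bsub>A\<^esub> inv\<^bsub>A\<^esub> r x"]
          by (cases "x \<in> carrier A") simp_all
      qed
    qed
    have "?to (?from (f, g)) = (f, g)" if f: "f \<in> homs (A\<lparr>carrier := ?C\<rparr>) G" and g: "g \<in> homs (A\<lparr>carrier := ?K\<rparr>) G" for f g
    proof -
      have fg1: "f \<one>\<^bsub>A\<^esub> = \<one>\<^bsub>G\<^esub>" "g \<one>\<^bsub>A\<^esub> = \<one>\<^bsub>G\<^esub>"
        using hom_one[OF homsD(4)[OF f]] hom_one[OF homsD(4)[OF g]]
          A.subgroup_imp_group[OF r.img_is_subgroup] A.subgroup_imp_group[OF r.subgroup_kernel] by simp_all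
      have "restrict (?from (f, g)) ?C = f"
      proof
        fix x show "restrict (?from (f, g)) ?C x = f x"
          using sub rr homsD(1,3)[OF f] fg1 by (cases "x \<in> ?C") (auto simp: subset_iff)
      qed
      moreover have "restrict (?from (f, g)) ?K = g"
      proof
        fix x show "restrict (?from (f, g)) ?K x = g x"
          using homsD(1,3)[OF g] fg1 by (cases "x \<in> ?K") (auto simp: kernel_def)
      qed
      ultimately show "?to (?from (f, g)) = (f, g)" by simp
    qed
    then show "\<forall>fg\<in>homs (A\<lparr>carrier := ?C\<rparr>) G \<times> homs (A\<lparr>carrier := ?K\<rparr>) G. ?to (?from fg) = fg"
      by blast
    show "?to ` homs A G \<subseteq> homs (A\<lparr>carrier := ?C\<rparr>) G \<times> homs (A\<lparr>carrier := ?K\<rparr>) G"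
    proof (rule image_subsetI)
      fix f assume f: "f \<in> homs A G"
      have "restrict f ?C \<in> homs (A\<lparr>carrier := ?C\<rparr>) G"
        using homsD[OF f] subgroup.m_closed[OF r.img_is_subgroup] sub by (intro homsI) (auto simp: subset_iff)
      moreover have "restrict f ?K \<in> homs (A\<lparr>carrier := ?K\<rparr>) G"
        using homsD[OF f] subgroup.m_closed[OF r.subgroup_kernel] sub by (intro homsI) (auto simp: subset_iff)
      ultimately show "?to f \<in> homs (A\<lparr>carrier := ?C\<rparr>) G \<times> homs (A\<lparr>carrier := ?K\<rparr>) G" by simp
    qed
    have "?from (f, g) \<in> homs A G" if f: "f \<in> homs (A\<lparr>carrier := ?C\<rparr>) G" and g: "g \<in> homs (A\<lparr>carrier := ?K\<rparr>) G" for f g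
    proof -
      show ?thesis
      proof (rule homsI)
        fix x assume x: "x \<in> carrier A"
        then show "?from (f, g) x \<in> carrier G"
          using homsD(1)[OF f] homsD(1)[OF g] sK by simp
        fix y assume y: "y \<in> carrier A"
        have "x \<otimes>\<^bsub>A\<^esub> y \<otimes>\<^bsub>A\<^esub> inv\<^bsub>A\<^esub> r (x \<otimes>\<^bsub>A\<^esub> y) = (x \<otimes>\<^bsub>A\<^esub> inv\<^bsub>A\<^esub> r x) \<otimes>\<^bsub>A\<^esub> (y \<otimes>\<^bsub>A\<^esub> inv\<^bsub>A\<^esub> r y)"
          using x y by (simp add: A.inv_mult A.m_ac)
        then show "?from (f, g) (x \<otimes>\<^bsub>A\<^esub> y) = ?from (f, g) x \<otimes>\<^bsub>G\<^esub> ?from (f, g) y"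
          using x y homsD(1,2)[OF f] homsD(1,2)[OF g] sK by (simp add: G.m_ac)
      qed simp
    qed
    then show "?from ` (homs (A\<lparr>carrier := ?C\<rparr>) G \<times> homs (A\<lparr>carrier := ?K\<rparr>) G) \<subseteq> homs A G"
      by blast
  qed
  then show ?thesis by (simp add: bij_betw_same_card card_cartesian_product)
qed

text \<open>The dual statement: the decomposition is applied to the values, composing with the two
  projections instead of restricting.\<close>

lemma card_homs_to_split:
  assumes A: "comm_group A" and G: "comm_group G" and r: "r \<in> hom A A"
    and rr: "\<And>x. x \<in> carrier A \<Longrightarrow> r (r x) = r x"
  shows "card (homs G A) = card (homs G (A\<lparr>carrier := r ` carrier A\<rparr>)) * card (homs G (A\<lparr>carrier := kernel A A r\<rparr>))"
proof -
  interpret A: comm_group A by fact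
  interpret G: comm_group G by fact
  interpret r: group_hom A A r using r by (simp add: group_hom_def group_hom_axioms_def)
  let ?C = "r ` carrier A" and ?K = "kernel A A r"
  have sub: "?C \<subseteq> carrier A" "?K \<subseteq> carrier A" by (auto simp: kernel_def)
  have sK: "x \<otimes>\<^bsub>A\<^esub> inv\<^bsub>A\<^esub> r x \<in> ?K" if "x \<in> carrier A" for x
    using that by (simp add: kernel_def rr)
  have split: "r x \<otimes>\<^bsub>A\<^esub> (x \<otimes>\<^bsub>A\<^esub> inv\<^bsub>A\<^esub> r x) = x" if "x \<in> carrier A" for x
    using that by (simp add: A.m_lcomm)
  let ?to = "\<lambda>f. (\<lambda>x\<in>carrier G. r (f x), \<lambda>x\<in>carrier G. f x \<otimes>\<^bsub>A\<^esub> inv\<^bsub>A\<^esub> r (f x))"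
  let ?from = "\<lambda>(f, g). \<lambda>x\<in>carrier G. f x \<otimes>\<^bsub>A\<^esub> g x"
  have "bij_betw ?to (homs G A) (homs G (A\<lparr>carrier := ?C\<rparr>) \<times> homs G (A\<lparr>carrier := ?K\<rparr>))"
  proof (rule bij_betw_byWitness[where f' = ?from])
    show "\<forall>f\<in>homs G A. ?from (?to f) = f"
    proof
      fix f assume f: "f \<in> homs G A"
      show "?from (?to f) = f"
      proof
        fix x show "?from (?to f) x = f x"
          using homsD(1,3)[OF f] split[of "f x"] by (cases "x \<in> carrier G") simp_all
      qed
    qed
    have "?to (?from (f, g)) = (f, g)" if f: "f \<in> homs G (A\<lparr>carrier := ?C\<rparr>)" and g: "g \<in> homs G (A\<lparr>carrier := ?K\<rparr>)" for f g
    proof -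
      have fx: "r (f x) = f x" "f x \<in> carrier A" if "x \<in> carrier G" for x
        using homsD(1)[OF f that] rr sub by auto
      have gx: "r (g x) = \<one>\<^bsub>A\<^esub>" "g x \<in> carrier A" if "x \<in> carrier G" for x
        using homsD(1)[OF g that] by (auto simp: kernel_def)
      have "fst (?to (?from (f, g))) = f"
      proof
        fix x show "fst (?to (?from (f, g))) x = f x"
          using homsD(3)[OF f] fx gx by (cases "x \<in> carrier G") simp_all
      qed
      moreover have "snd (?to (?from (f, g))) = g"
      proof
        fix x show "snd (?to (?from (f, g))) x = g x"
          using homsD(3)[OF g] fx gx A.m_comm[of "f x" "g x"]
          by (cases "x \<in> carrier G") (simp_all add: A.m_assoc)
      qed
      ultimately show "?to (?from (f, g)) = (f, g)" by (simp add: prod_eq_iff)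
    qed
    then show "\<forall>fg\<in>homs G (A\<lparr>carrier := ?C\<rparr>) \<times> homs G (A\<lparr>carrier := ?K\<rparr>). ?to (?from fg) = fg"
      by blast
    show "?to ` homs G A \<subseteq> homs G (A\<lparr>carrier := ?C\<rparr>) \<times> homs G (A\<lparr>carrier := ?K\<rparr>)"
    proof (rule image_subsetI)
      fix f assume f: "f \<in> homs G A"
      have "(\<lambda>x\<in>carrier G. r (f x)) \<in> homs G (A\<lparr>carrier := ?C\<rparr>)"
        using homsD[OF f] by (intro homsI) auto
      moreover have "(\<lambda>x\<in>carrier G. f x \<otimes>\<^bsub>A\<^esub> inv\<^bsub>A\<^esub> r (f x)) \<in> homs G (A\<lparr>carrier := ?K\<rparr>)"
        using homsD[OF f] sK by (intro homsI) (auto simp: A.inv_mult A.m_ac)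
      ultimately show "?to f \<in> homs G (A\<lparr>carrier := ?C\<rparr>) \<times> homs G (A\<lparr>carrier := ?K\<rparr>)" by simp
    qed
    have "?from (f, g) \<in> homs G A" if f: "f \<in> homs G (A\<lparr>carrier := ?C\<rparr>)" and g: "g \<in> homs G (A\<lparr>carrier := ?K\<rparr>)" for f g
    proof -
      have "f x \<in> carrier A" "g x \<in> carrier A" if "x \<in> carrier G" for x
        using homsD(1)[OF f that] homsD(1)[OF g that] sub by auto
      then show ?thesis
        using homsD(2)[OF f] homsD(2)[OF g] by (intro homsI) (auto simp: A.m_ac)
    qed
    then show "?from ` (homs G (A\<lparr>carrier := ?C\<rparr>) \<times> homs G (A\<lparr>carrier := ?K\<rparr>)) \<subseteq> homs G A"
      by blast
  qed
  then show ?thesis by (simp add: bij_betw_same_card card_cartesian_product)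
qed

text \<open>A homomorphism is determined by its value at the generator, which can be any element
  killed by the order of \<open>c\<close>.\<close>

lemma card_homs_from_cyclic:
  assumes A: "comm_group A" and c: "c \<in> carrier A" and gen: "carrier A = range (\<lambda>z::int. c [^]\<^bsub>A\<^esub> z)"
    and G: "comm_group G"
  shows "card (homs A G) = card {g \<in> carrier G. g [^]\<^bsub>G\<^esub> group.ord A c = \<one>\<^bsub>G\<^esub>}"
proof (rule bij_betw_same_card)
  interpret A: comm_group A by fact
  interpret G: comm_group G by fact
  have fz: "f (c [^]\<^bsub>A\<^esub> z) = f c [^]\<^bsub>G\<^esub> z" if "f \<in> homs A G" for f and z :: int
    using hom_int_pow[OF homsD(4)[OF that] c A.is_group G.is_group] .
  show "bij_betw (\<lambda>f. f c) (homs A G) {g \<in> carrier G. g [^]\<^bsub>G\<^esub> A.ord c = \<one>\<^bsub>G\<^esub>}"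
  proof (rule bij_betw_imageI)
    show "inj_on (\<lambda>f. f c) (homs A G)"
    proof (rule inj_onI)
      fix f g assume fg: "f \<in> homs A G" "g \<in> homs A G" "f c = g c"
      show "f = g"
      proof (rule homs_eqI[OF fg(1,2)])
        fix x assume "x \<in> carrier A"
        then obtain z :: int where "x = c [^]\<^bsub>A\<^esub> z" using gen by auto
        then show "f x = g x" using fg(3) fz[OF fg(1)] fz[OF fg(2)] by simp
      qed
    qed
    show "(\<lambda>f. f c) ` homs A G = {g \<in> carrier G. g [^]\<^bsub>G\<^esub> A.ord c = \<one>\<^bsub>G\<^esub>}" (is "?L = ?R")
    proof
      show "?L \<subseteq> ?R"
      proof clarify
        fix f assume f: "f \<in> homs A G"
        have "f c [^]\<^bsub>G\<^esub> A.ord c = f (c [^]\<^bsub>A\<^esub> A.ord c)"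
          using fz[OF f, of "int (A.ord c)"] by (simp add: int_pow_int)
        also have "\<dots> = \<one>\<^bsub>G\<^esub>"
          using c hom_one[OF homsD(4)[OF f] A.is_group G.is_group] by simp
        finally show "f c \<in> carrier G \<and> f c [^]\<^bsub>G\<^esub> A.ord c = \<one>\<^bsub>G\<^esub>"
          using homsD(1)[OF f c] by simp
      qed
      show "?R \<subseteq> ?L"
      proof clarify
        fix g assume g: "g \<in> carrier G" "g [^]\<^bsub>G\<^esub> A.ord c = \<one>\<^bsub>G\<^esub>"
        \<comment> \<open>Existence comes from gluing the trivial map on the trivial subgroup with
          \<open>n \<mapsto> g [^] n\<close> on the integers; agreement means that \<open>g\<close>
          is killed by every exponent killing \<open>c\<close>.\<close>
        have triv: "(\<lambda>x. \<one>\<^bsub>G\<^esub>) \<in> hom (A\<lparr>carrier := {\<one>\<^bsub>A\<^esub>}\<rparr>) G" by (simp add: hom_def)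
        have "\<forall>n::int\<in>UNIV. c [^]\<^bsub>A\<^esub> n \<in> {\<one>\<^bsub>A\<^esub>} \<longrightarrow> \<one>\<^bsub>G\<^esub> = g [^]\<^bsub>G\<^esub> n"
          using c g G.int_pow_eq_one_dvd by (simp add: A.int_pow_eq_id)
        then have "\<exists>D F. subgroup D A \<and> {\<one>\<^bsub>A\<^esub>} \<subseteq> D \<and> range (\<lambda>z::int. c [^]\<^bsub>A\<^esub> z) \<subseteq> D
          \<and> F \<in> hom (A\<lparr>carrier := D\<rparr>) G \<and> (\<forall>h\<in>{\<one>\<^bsub>A\<^esub>}. F h = \<one>\<^bsub>G\<^esub>)
          \<and> (\<forall>z::int\<in>UNIV. F (c [^]\<^bsub>A\<^esub> z) = g [^]\<^bsub>G\<^esub> z)"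
          by (rule A.hom_glue[OF G A.triv_subgroup triv group_integer_group A.hom_integer_group_pow[OF c]
            G.hom_integer_group_pow[OF g(1)], unfolded carrier_integer_group])
        then obtain D F where DF: "subgroup D A \<and> {\<one>\<^bsub>A\<^esub>} \<subseteq> D \<and> range (\<lambda>z::int. c [^]\<^bsub>A\<^esub> z) \<subseteq> D
          \<and> F \<in> hom (A\<lparr>carrier := D\<rparr>) G \<and> (\<forall>h\<in>{\<one>\<^bsub>A\<^esub>}. F h = \<one>\<^bsub>G\<^esub>)
          \<and> (\<forall>z::int\<in>UNIV. F (c [^]\<^bsub>A\<^esub> z) = g [^]\<^bsub>G\<^esub> z)"
          by (elim exE) (rule that)
        note D = DF[THEN conjunct1] DF[THEN conjunct2, THEN conjunct2, THEN conjunct1]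
        note F = DF[THEN conjunct2, THEN conjunct2, THEN conjunct2, THEN conjunct1]
        have Fc: "F (c [^]\<^bsub>A\<^esub> (1::int)) = g [^]\<^bsub>G\<^esub> (1::int)" using DF by simp
        have DA: "D = carrier A" using D(2) subgroup.subset[OF D(1)] unfolding gen[symmetric] by (rule subset_antisym[rotated])
        then have "restrict F (carrier A) \<in> homs A G"
          using F by (intro homsI) (auto simp: hom_def)
        moreover have "restrict F (carrier A) c = g"
          using Fc c g by simp
        ultimately show "g \<in> ?L" by (metis image_eqI)
      qed
    qed
  qed
qed

text \<open>Both sides count the rationals in [0,1) that become integers after multiplication by
  \<open>m\<close> and by \<open>n\<close>, written as \<open>j / n\<close> on the left and
  \<open>i / m\<close> on the right; the common value is the gcd.\<close>

lemma card_dvd_mult_swap: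
  assumes "0 < m" "0 < n"
  shows "card {j::nat. j < n \<and> n dvd j * m} = card {i. i < m \<and> m dvd i * n}"
proof (rule bij_betw_same_card, rule bij_betw_byWitness[where f = "\<lambda>j. j * m div n" and f' = "\<lambda>i. i * n div m"])
  have *: "i * n div m < n \<and> n dvd i * n div m * m \<and> i * n div m * m div n = i" 
    if "0 < m" "0 < n" "i < m" "m dvd i * n" for i m n :: nat
    using that by (auto simp: div_less_iff_less_mult)
  show "\<forall>j\<in>{j. j < n \<and> n dvd j * m}. (j * m div n) * n div m = j"
    using *[of n m] assms by auto
  show "\<forall>i\<in>{i. i < m \<and> m dvd i * n}. (i * n div m) * m div n = i"
    using *[of m n] assms by auto
  show "(\<lambda>j. j * m div n) ` {j. j < n \<and> n dvd j * m} \<subseteq> {i. i < m \<and> m dvd i * n}"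
    using *[of n m] assms by auto
  show "(\<lambda>i. i * n div m) ` {i. i < m \<and> m dvd i * n} \<subseteq> {j. j < n \<and> n dvd j * m}"
    using *[of m n] assms by auto
qed

lemma card_torsion_cyclic:
  assumes A: "comm_group A" "finite (carrier A)" and c: "c \<in> carrier A"
    and gen: "carrier A = range (\<lambda>z::int. c [^]\<^bsub>A\<^esub> z)"
  shows "card {x \<in> carrier A. x [^]\<^bsub>A\<^esub> m = \<one>\<^bsub>A\<^esub>}
    = card {j. j < group.ord A c \<and> group.ord A c dvd j * m}"
proof -
  interpret A: comm_group A by fact
  have n: "0 < A.ord c" using A.ord_ge_1[OF A(2) c] by simp
  have "bij_betw (\<lambda>j. c [^]\<^bsub>A\<^esub> j) {j. j < A.ord c \<and> A.ord c dvd j * m}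
    {x \<in> carrier A. x [^]\<^bsub>A\<^esub> m = \<one>\<^bsub>A\<^esub>}"
  proof (rule bij_betw_imageI)
    have "inj_on (\<lambda>j. c [^]\<^bsub>A\<^esub> j) {0..A.ord c - 1}" using A.ord_inj[OF c] .
    then show "inj_on (\<lambda>j. c [^]\<^bsub>A\<^esub> j) {j. j < A.ord c \<and> A.ord c dvd j * m}"
      by (rule inj_on_subset) auto
    have "c [^]\<^bsub>A\<^esub> z = c [^]\<^bsub>A\<^esub> nat (z mod int (A.ord c))" for z :: int
    proof -
      have "c [^]\<^bsub>A\<^esub> z = c [^]\<^bsub>A\<^esub> int (nat (z mod int (A.ord c)))"
        using n c by (simp add: A.int_pow_eq mod_eq_dvd_iff[symmetric])
      then show ?thesis by (simp add: int_pow_int)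
    qed
    moreover have "nat (z mod int (A.ord c)) < A.ord c" for z using n by (simp add: nat_less_iff)
    ultimately have "\<exists>j<A.ord c. x = c [^]\<^bsub>A\<^esub> j" if "x \<in> carrier A" for x
      using that gen by (metis rangeE)
    moreover have "(c [^]\<^bsub>A\<^esub> j) [^]\<^bsub>A\<^esub> m = \<one>\<^bsub>A\<^esub> \<longleftrightarrow> A.ord c dvd j * m" for j :: nat
      using c by (simp add: A.nat_pow_pow A.pow_eq_id)
    ultimately show "(\<lambda>j. c [^]\<^bsub>A\<^esub> j) ` {j. j < A.ord c \<and> A.ord c dvd j * m} = {x \<in> carrier A. x [^]\<^bsub>A\<^esub> m = \<one>\<^bsub>A\<^esub>}"
      using c by fastforce
  qed
  then show ?thesis by (simp add: bij_betw_same_card)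
qed

theorem card_homs_swap:
  assumes "comm_group A" "finite (carrier A)" "comm_group G" "finite (carrier G)"
  shows "card (homs A G) = card (homs G A)"
  using assms
proof (induction A arbitrary: G rule: finite_comm_group_induct)
  case (cyclic A c)
  from \<open>comm_group G\<close> \<open>finite (carrier G)\<close> show ?case
  proof (induction G rule: finite_comm_group_induct)
    case (cyclic G b)
    note A = \<open>comm_group A\<close> \<open>finite (carrier A)\<close> \<open>c \<in> carrier A\<close> \<open>carrier A = range (\<lambda>z::int. c [^]\<^bsub>A\<^esub> z)\<close>
    \<comment> \<open>For two cyclic groups each count is the number of elements of one group killed
      by the order of the other, hence the symmetric number of
      \<open>card_dvd_mult_swap\<close>.\<close>
    have "0 < group.ord A c" "0 < group.ord G b"
      using group.ord_ge_1[OF comm_group.axioms(2)] A cyclic by (metis less_eq_Suc_le One_nat_def)+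
    then show ?case
      using card_homs_from_cyclic[OF A(1,3,4) cyclic(1)] card_homs_from_cyclic[OF cyclic(1,3,4) A(1)]
        card_torsion_cyclic[OF A] card_torsion_cyclic[OF cyclic] card_dvd_mult_swap by metis
  next
    case (split G r)
    then show ?case
      using card_homs_from_split[OF split(1) \<open>comm_group A\<close> split(3,4)]
        card_homs_to_split[OF split(1) \<open>comm_group A\<close> split(3,4)] by simp
  qed
next
  case (split A r)
  then show ?case
    using card_homs_from_split[OF split(1) \<open>comm_group G\<close> split(3,4)]
      card_homs_to_split[OF split(1) \<open>comm_group G\<close> split(3,4)] by simp
qed

section \<open>Radicals and torsion of quotients\<close>

definition rad :: "('a,'m) monoid_scheme \<Rightarrow> 'a set \<Rightarrow> 'a set" where
  "rad Gm H = {x \<in> carrier Gm. \<exists>n::nat. n > 0 \<and> x [^]\<^bsub>Gm\<^esub> n \<in> H}"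

text \<open>Membership in the singleton, instead of an equation, makes this literally an instance of
  \<open>subgroup_homs_constrained\<close>.\<close>

definition ann :: "('a,'m) monoid_scheme \<Rightarrow> ('b,'n) monoid_scheme \<Rightarrow> 'a set \<Rightarrow> 'a set \<Rightarrow> ('a \<Rightarrow> 'b) set" where
  "ann Gm L K H = {f \<in> homs (Gm\<lparr>carrier := K\<rparr>) L. \<forall>h\<in>H. f h \<in> {\<one>\<^bsub>L\<^esub>}}"

context comm_group
begin

lemma rad_subset: "rad G H \<subseteq> carrier G"
  by (auto simp: rad_def)

lemma subset_rad: "subgroup H G \<Longrightarrow> H \<subseteq> rad G H"
  using subgroup.mem_carrier by (fastforce simp: rad_def intro: exI[of _ "1::nat"])

lemma radE:
  assumes "x \<in> rad G H"
  obtains n :: nat where "0 < n" "x [^] n \<in> H"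
  using assms by (auto simp: rad_def)

lemma rad_mono: "H \<subseteq> K \<Longrightarrow> rad G H \<subseteq> rad G K"
  by (auto simp: rad_def)

lemma rad_subgroup:
  assumes "subgroup H G"
  shows "subgroup (rad G H) G"
proof (rule subgroupI)
  interpret H: subgroup H G by fact
  show "rad G H \<subseteq> carrier G" by (rule rad_subset)
  show "rad G H \<noteq> {}" using subset_rad[OF assms] H.one_closed by blast
  show "inv x \<in> rad G H" if "x \<in> rad G H" for x
    using that by (auto simp: rad_def nat_pow_inv)
  fix x y assume "x \<in> rad G H" "y \<in> rad G H"
  then obtain m n :: nat where mn: "0 < m" "x [^] m \<in> H" "0 < n" "y [^] n \<in> H"
    and xy: "x \<in> carrier G" "y \<in> carrier G" by (auto simp: rad_def)
  have "(x \<otimes> y) [^] (m * n) = (x [^] m) [^] n \<otimes> (y [^] n) [^] m"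
    using xy by (simp add: nat_pow_distrib nat_pow_pow mult.commute)
  also have "\<dots> \<in> H" using mn subgroup_nat_pow_closed[OF assms] by simp
  finally show "x \<otimes> y \<in> rad G H" using mn xy by (auto simp: rad_def intro!: exI[of _ "m * n"])
qed

lemma rad_rad: 
  assumes "H \<subseteq> rad G K"
  shows "rad G H \<subseteq> rad G K"
proof
  fix x assume "x \<in> rad G H"
  then obtain n :: nat where n: "x \<in> carrier G" "0 < n" "x [^] n \<in> H" by (auto simp: rad_def)
  then have "x [^] n \<in> rad G K" using assms by blast
  then obtain m :: nat where "0 < m" "(x [^] n) [^] m \<in> K" by (auto simp: rad_def)
  then show "x \<in> rad G K" using n by (auto simp: rad_def nat_pow_pow intro!: exI[of _ "n * m"])
qed

lemma rad_int_pow: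
  assumes "subgroup H G" "x \<in> carrier G" "x [^] (z::int) \<in> H" "z \<noteq> 0"
  shows "x \<in> rad G H"
proof -
  obtain n where n: "z = int n \<or> z = - int n" by (metis int_cases2)
  have "x [^] n \<in> H"
  proof (cases "z = int n")
    case True
    then show ?thesis using assms(3) by (simp add: int_pow_int)
  next
    case False
    then have "inv (x [^] n) \<in> H" using n assms(2,3) by (simp add: int_pow_neg_int)
    then show ?thesis using subgroup.m_inv_closed[OF assms(1)] assms(2) by fastforce
  qed
  moreover have "0 < n" using n assms(4) by auto
  ultimately show ?thesis using assms(2) by (auto simp: rad_def)
qed

lemma rcoset_eq_iff:
  assumes "subgroup N G" "x \<in> carrier G" "y \<in> carrier G"
  shows "N #> x = N #> y \<longleftrightarrow> x \<otimes> inv y \<in> N"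
  by (metis assms repr_independence rcos_self subgroup.rcos_module is_group)

text \<open>The image of \<open>K\<close> modulo \<open>N\<close> is
  \<open>K / (K \<inter> N)\<close>. The subgroup \<open>K\<close> may fail to contain
  \<open>N\<close>: besides \<open>K = rad N\<close>, the lemma is applied to the radical of a
  smaller span modulo \<open>span T\<close>.\<close>

lemma card_homs_quotient:
  assumes N: "subgroup N G" and K: "subgroup K G" and L: "comm_group L"
  shows "card (homs ((G Mod N)\<lparr>carrier := (\<lambda>x. N #> x) ` K\<rparr>) L) = card (ann G L K (K \<inter> N))"
proof (rule bij_betw_same_card)
  interpret L: comm_group L by fact
  interpret K: subgroup K G by fact
  interpret N: normal N G using N by (rule subgroup_imp_normal)
  let ?Q = "(G Mod N)\<lparr>carrier := (\<lambda>x. N #> x) ` K\<rparr>"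
  have QK: "subgroup ((\<lambda>x. N #> x) ` K) (G Mod N)"
  proof -
    interpret p: group_hom G "G Mod N" "\<lambda>x. N #> x"
      using N.r_coset_hom_Mod N.factorgroup_is_group by (simp add: group_hom_def group_hom_axioms_def)
    show ?thesis using K by (rule p.subgroup_img_is_subgroup)
  qed
  then have Q: "group ?Q" using group.subgroup_imp_group[OF N.factorgroup_is_group] by simp
  show "bij_betw (\<lambda>\<phi>. \<lambda>x\<in>K. \<phi> (N #> x)) (homs ?Q L) (ann G L K (K \<inter> N))"
  proof (rule bij_betw_imageI)
    show "inj_on (\<lambda>\<phi>. \<lambda>x\<in>K. \<phi> (N #> x)) (homs ?Q L)"
    proof (rule inj_onI)
      fix \<phi> \<psi> assume \<phi>: "\<phi> \<in> homs ?Q L" and \<psi>: "\<psi> \<in> homs ?Q L"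
        and eq: "(\<lambda>x\<in>K. \<phi> (N #> x)) = (\<lambda>x\<in>K. \<psi> (N #> x))"
      have "\<phi> (N #> x) = \<psi> (N #> x)" if "x \<in> K" for x using fun_cong[OF eq, of x] that by simp
      then show "\<phi> = \<psi>" by (intro homs_eqI[OF \<phi> \<psi>]) auto
    qed
    show "(\<lambda>\<phi>. \<lambda>x\<in>K. \<phi> (N #> x)) ` homs ?Q L = ann G L K (K \<inter> N)" (is "?L = ?R")
    proof
      show "?L \<subseteq> ?R"
      proof (rule image_subsetI)
        fix \<phi> assume \<phi>: "\<phi> \<in> homs ?Q L"
        have "(\<lambda>x\<in>K. \<phi> (N #> x)) \<in> homs (G\<lparr>carrier := K\<rparr>) L"
        proof (rule homsI)
          show "(\<lambda>x\<in>K. \<phi> (N #> x)) x \<in> carrier L" if "x \<in> carrier (G\<lparr>carrier := K\<rparr>)" for x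
            using that homsD(1)[OF \<phi>] by simp
          fix x y assume "x \<in> carrier (G\<lparr>carrier := K\<rparr>)" "y \<in> carrier (G\<lparr>carrier := K\<rparr>)"
          then have xy: "x \<in> K" "y \<in> K" by simp_all
          have "N #> (x \<otimes> y) = (N #> x) <#> (N #> y)" using xy by (simp add: N.rcos_sum)
          then show "(\<lambda>x\<in>K. \<phi> (N #> x)) (x \<otimes>\<^bsub>G\<lparr>carrier := K\<rparr>\<^esub> y)
            = (\<lambda>x\<in>K. \<phi> (N #> x)) x \<otimes>\<^bsub>L\<^esub> (\<lambda>x\<in>K. \<phi> (N #> x)) y"
            using homsD(2)[OF \<phi>, of "N #> x" "N #> y"] xy by simp
        qed simp
        moreover have "\<phi> N = \<one>\<^bsub>L\<^esub>" using hom_one[OF homsD(4)[OF \<phi>] Q L.is_group] by simp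
        ultimately show "(\<lambda>x\<in>K. \<phi> (N #> x)) \<in> ?R"
          by (auto simp: ann_def coset_join2[OF _ N])
      qed
      show "?R \<subseteq> ?L"
      proof
        fix f assume "f \<in> ?R"
        then have f: "f \<in> homs (G\<lparr>carrier := K\<rparr>) L" and f1: "\<And>h. h \<in> K \<Longrightarrow> h \<in> N \<Longrightarrow> f h = \<one>\<^bsub>L\<^esub>"
          by (auto simp: ann_def)
        have fc: "f x \<in> carrier L" if "x \<in> K" for x using homsD(1)[OF f] that by simp
        have fm: "f (x \<otimes> y) = f x \<otimes>\<^bsub>L\<^esub> f y" if "x \<in> K" "y \<in> K" for x y
          using homsD(2)[OF f] that by simp
        \<comment> \<open>The choice is harmless: two representatives in \<open>K\<close> of one
          coset differ by an element of \<open>K \<inter> N\<close>, where \<open>f\<close> is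
          trivial.\<close>
        define \<phi> where "\<phi> = (\<lambda>V\<in>(\<lambda>x. N #> x) ` K. f (SOME x. x \<in> K \<and> V = N #> x))"
        have \<phi>: "\<phi> (N #> x) = f x" if x: "x \<in> K" for x
        proof -
          define y where "y = (SOME y. y \<in> K \<and> N #> x = N #> y)"
          have y: "y \<in> K" "N #> x = N #> y"
            using someI[of "\<lambda>y. y \<in> K \<and> N #> x = N #> y" x] x by (auto simp: y_def)
          have "x \<otimes> inv y \<in> N" using rcoset_eq_iff[OF N] x y by simp
          then have "f (x \<otimes> inv y) = \<one>\<^bsub>L\<^esub>" using f1 x y by simp
          then have "f (x \<otimes> inv y \<otimes> y) = f y" using fm[of "x \<otimes> inv y" y] fc x y by simp
          then have "f x = f y" using x y by (simp add: m_assoc)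
          then show ?thesis using x by (simp add: \<phi>_def y_def)
        qed
        have "\<phi> \<in> homs ?Q L"
        proof (rule homsI)
          show "\<phi> V \<in> carrier L" if "V \<in> carrier ?Q" for V using that \<phi> fc by auto
          show "\<phi> V = undefined" if "V \<notin> carrier ?Q" for V using that by (simp add: \<phi>_def)
          fix V Y assume "V \<in> carrier ?Q" "Y \<in> carrier ?Q"
          then obtain x y where xy: "x \<in> K" "y \<in> K" "V = N #> x" "Y = N #> y" by auto
          then have "V <#> Y = N #> (x \<otimes> y)" by (simp add: N.rcos_sum)
          then show "\<phi> (V \<otimes>\<^bsub>?Q\<^esub> Y) = \<phi> V \<otimes>\<^bsub>L\<^esub> \<phi> Y" using xy \<phi> fm by simp
        qed
        moreover have "(\<lambda>x\<in>K. \<phi> (N #> x)) = f"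
          using \<phi> homsD(3)[OF f] by (auto simp: fun_eq_iff)
        ultimately show "f \<in> ?L" by (intro image_eqI[of _ _ \<phi>]) simp_all
      qed
    qed
  qed
qed

lemma torsion_subgroup_Mod:
  assumes N: "subgroup N G"
  shows "torsion_subgroup (G Mod N) = (G Mod N)\<lparr>carrier := (\<lambda>x. N #> x) ` rad G N\<rparr>"
proof -
  interpret N: normal N G using N by (rule subgroup_imp_normal)
  have "(N #> x) [^]\<^bsub>G Mod N\<^esub> n = N \<longleftrightarrow> x [^] n \<in> N" if "x \<in> carrier G" for x and n :: nat
    unfolding N.FactGroup_pow[OF that]
    using coset_join1[of N "x [^] n"] coset_join2[of "x [^] n" N] N N.subset nat_pow_closed[OF that]
    by metis
  then have "{V \<in> carrier (G Mod N). \<exists>n::nat. n > 0 \<and> V [^]\<^bsub>G Mod N\<^esub> n = \<one>\<^bsub>G Mod N\<^esub>} = (\<lambda>x. N #> x) ` rad G N"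
    by (auto simp: carrier_FactGroup rad_def)
  then show ?thesis by (simp add: torsion_subgroup_def)
qed

lemma mem_mult_powers_iff:
  "t \<in> D <#> range (\<lambda>z::int. a [^] z) \<longleftrightarrow> (\<exists>d\<in>D. \<exists>z::int. t = d \<otimes> a [^] z)"
  by (auto simp: set_mult_def)

lemma generate_insert:
  assumes "W \<subseteq> carrier G" "a \<in> carrier G"
  shows "generate G (insert a W) = generate G W <#> range (\<lambda>z::int. a [^] z)"
proof -
  have sW: "subgroup (generate G W) G" and sa: "subgroup (range (\<lambda>z::int. a [^] z)) G"
    using assms generate_is_subgroup subgroup_of_powers by auto
  have sI: "subgroup (generate G (insert a W)) G" using assms by (intro generate_is_subgroup) auto
  show ?thesis
  proof
    have "a = \<one> \<otimes> a [^] (1::int)" using assms by simp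
    then have "a \<in> generate G W <#> range (\<lambda>z::int. a [^] z)"
      unfolding mem_mult_powers_iff using subgroup.one_closed[OF sW] by metis
    moreover have "x \<in> generate G W <#> range (\<lambda>z::int. a [^] z)" if "x \<in> W" for x
    proof -
      have x: "x \<in> generate G W" using that by (rule generate.incl)
      have "x = x \<otimes> a [^] (0::int)" using that assms by (simp add: subset_iff)
      then show ?thesis unfolding mem_mult_powers_iff using x by metis
    qed
    ultimately show "generate G (insert a W) \<subseteq> generate G W <#> range (\<lambda>z::int. a [^] z)"
      by (intro generate_subgroup_incl mult_subgroups sW sa) auto
    have "generate G W \<subseteq> generate G (insert a W)" by (intro mono_generate) auto
    moreover have "a [^] z \<in> generate G (insert a W)" for z :: int
      by (rule subgroup_int_pow_closed[OF sI generate.incl]) simp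
    ultimately have "h \<otimes> a [^] z \<in> generate G (insert a W)" if "h \<in> generate G W" for h and z :: int
      using subgroup.m_closed[OF sI] that by (simp add: subset_iff)
    then show "generate G W <#> range (\<lambda>z::int. a [^] z) \<subseteq> generate G (insert a W)"
      by (auto simp: mem_mult_powers_iff)
  qed
qed

text \<open>If no power of \<open>a\<close> lies in \<open>D\<close>, adjoining \<open>a\<close> creates no new torsion; otherwise \<open>D\<close> has finite
  index and the torsion in each coset of \<open>D\<close> is a translate of the torsion in \<open>D\<close>.\<close>
lemma finite_rad_cosets_step:
  assumes H: "subgroup H G" and D: "subgroup D G" "H \<subseteq> D" and a: "a \<in> carrier G"
    and fin: "finite ((\<lambda>x. H #> x) ` (rad G H \<inter> D))"
  shows "finite ((\<lambda>x. H #> x) ` (rad G H \<inter> (D <#> range (\<lambda>z::int. a [^] z))))"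
proof -
  interpret D: subgroup D G by fact
  interpret R: subgroup "rad G H" G using H by (rule rad_subgroup)
  show ?thesis
  proof (cases "a \<in> rad G D")
    case False
    have "rad G H \<inter> (D <#> range (\<lambda>z::int. a [^] z)) \<subseteq> rad G H \<inter> D"
    proof clarify
      fix t assume t: "t \<in> rad G H" "t \<in> D <#> range (\<lambda>z::int. a [^] z)"
      from t(2) obtain d and z :: int where dz: "d \<in> D" "t = d \<otimes> a [^] z"
        unfolding mem_mult_powers_iff by (elim bexE exE) (rule that)
      from t(1) obtain n :: nat where n: "0 < n" "t [^] n \<in> H" by (rule radE)
      have "t [^] n = d [^] n \<otimes> a [^] (z * int n)"
        using dz a int_pow_pow[OF a, of z "int n"] by (simp add: nat_pow_distrib int_pow_int)
      then have "a [^] (z * int n) = inv (d [^] n) \<otimes> t [^] n"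
        by (subst inv_solve_left) (use a dz t(1) R.mem_carrier in auto)
      also have "\<dots> \<in> D" using dz n D(2) subgroup_nat_pow_closed[OF D(1)] by blast
      finally have "z * int n = 0" using False rad_int_pow[OF D(1) a] by blast
      then show "t \<in> D" using n dz by simp
    qed
    then show ?thesis using fin by (meson finite_subset image_mono)
  next
    case True
    then obtain k :: nat where k: "0 < k" "a [^] k \<in> D" by (rule radE)
    define W where "W j = {t \<in> rad G H. \<exists>d\<in>D. t = d \<otimes> a [^] j}" for j :: nat
    have "finite ((\<lambda>x. H #> x) ` W j)" for j
    proof (cases "W j = {}")
      case False
      then obtain u e where u: "u \<in> rad G H" "e \<in> D" "u = e \<otimes> a [^] j" by (auto simp: W_def)
      have "(\<lambda>x. H #> x) ` W j \<subseteq> (\<lambda>C. C #> u) ` (\<lambda>x. H #> x) ` (rad G H \<inter> D)"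
      proof (rule image_subsetI)
        fix t assume "t \<in> W j"
        then obtain d where t: "t \<in> rad G H" "d \<in> D" "t = d \<otimes> a [^] j" by (auto simp: W_def)
        have "t \<otimes> inv u = d \<otimes> inv e"
          using t u a by (simp add: inv_mult m_ac)
        moreover have "d \<otimes> inv e \<in> D" using t u by blast
        moreover have "t \<otimes> inv u \<in> rad G H" using t u by blast
        ultimately have mem: "t \<otimes> inv u \<in> rad G H \<inter> D" by simp
        have "H #> t = (H #> (t \<otimes> inv u)) #> u"
          using t(1) u(1) subgroup.subset[OF H] by (simp add: coset_mult_assoc m_assoc)
        then show "H #> t \<in> (\<lambda>C. C #> u) ` (\<lambda>x. H #> x) ` (rad G H \<inter> D)" using mem by blast
      qed
      then show ?thesis using fin by (meson finite_imageI finite_subset)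
    qed simp
    moreover have "rad G H \<inter> (D <#> range (\<lambda>z::int. a [^] z)) \<subseteq> (\<Union>j<k. W j)"
    proof clarify
      fix t assume t: "t \<in> rad G H" "t \<in> D <#> range (\<lambda>z::int. a [^] z)"
      from t(2) obtain d and z :: int where dz: "d \<in> D" "t = d \<otimes> a [^] z"
        unfolding mem_mult_powers_iff by (elim bexE exE) (rule that)
      define j where "j = nat (z mod int k)"
      have j: "j < k" "z = int k * (z div int k) + int j" using k by (auto simp: j_def nat_less_iff)
      have "a [^] z = a [^] (int k * (z div int k) + int j)" using j(2) by simp
      also have "\<dots> = (a [^] k) [^] (z div int k) \<otimes> a [^] j"
        using a int_pow_pow[OF a, of "int k" "z div int k"] by (simp add: int_pow_mult int_pow_int)
      finally have "t = (d \<otimes> (a [^] k) [^] (z div int k)) \<otimes> a [^] j" using dz a by (simp add: m_assoc)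
      moreover have "d \<otimes> (a [^] k) [^] (z div int k) \<in> D"
        using dz subgroup_int_pow_closed[OF D(1) k(2)] by blast
      ultimately show "t \<in> (\<Union>j<k. W j)" using t(1) j(1) by (auto simp: W_def)
    qed
    then have "(\<lambda>x. H #> x) ` (rad G H \<inter> (D <#> range (\<lambda>z::int. a [^] z))) \<subseteq> (\<Union>j<k. (\<lambda>x. H #> x) ` W j)"
      by blast
    ultimately show ?thesis by (meson finite_UN_I finite_lessThan finite_subset)
  qed
qed

text \<open>A subgroup \<open>D\<close> grows from \<open>H\<close>, where only the trivial coset
  occurs, by one generator at a time until it is the whole group.\<close>

lemma finite_torsion_quotient:
  assumes H: "subgroup H G" and fg: "fin_gen_group G"
  shows "finite ((\<lambda>x. H #> x) ` rad G H)"
proof -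
  interpret H: subgroup H G by fact
  have *: "\<exists>D. subgroup D G \<and> H \<subseteq> D \<and> Y \<subseteq> D \<and> finite ((\<lambda>x. H #> x) ` (rad G H \<inter> D))"
    if "finite Y" "Y \<subseteq> carrier G" for Y
    using that
  proof (induction Y)
    case empty
    have "(\<lambda>x. H #> x) ` (rad G H \<inter> H) \<subseteq> {H}" using coset_join2[OF _ H] by auto
    then show ?case using H by (auto intro: finite_subset)
  next
    case (insert a Y)
    then obtain D where D: "subgroup D G" "H \<subseteq> D" "Y \<subseteq> D" "finite ((\<lambda>x. H #> x) ` (rad G H \<inter> D))"
      by auto
    from insert have a: "a \<in> carrier G" by simp
    interpret D: subgroup D G by fact
    let ?D = "D <#> range (\<lambda>z::int. a [^] z)"
    \<comment> \<open>Regarding \<open>D\<close> as generated by itself lets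
      \<open>generate_insert\<close> describe the enlarged subgroup.\<close>
    have DG: "D = generate G D"
      using generate_subgroup_incl[OF subset_refl D(1)] by (intro equalityI subsetI generate.incl) auto
    have eq: "?D = generate G (insert a D)" using generate_insert[OF D.subset a] DG by simp
    have "insert a D \<subseteq> ?D" unfolding eq by (auto intro: generate.incl)
    moreover have "subgroup ?D G"
      unfolding eq using a D.subset by (intro generate_is_subgroup) auto
    ultimately show ?case
      using finite_rad_cosets_step[OF H D(1,2) a D(4)] D by (intro exI[of _ ?D]) auto
  qed
  obtain Y where Y: "finite Y" "Y \<subseteq> carrier G" "generate G Y = carrier G"
    using fg by (auto simp: fin_gen_group_def)
  obtain D where D: "subgroup D G" "Y \<subseteq> D" "finite ((\<lambda>x. H #> x) ` (rad G H \<inter> D))"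
    using *[OF Y(1,2)] by blast
  have "D = carrier G" using generate_subgroup_incl[OF D(2,1)] Y(3) subgroup.subset[OF D(1)] by auto
  then show ?thesis using D(3) rad_subset by (simp add: Int_absorb2)
qed

end

text \<open>All values are killed by the order of \<open>A\<close>, so they lie in a finite torsion
  subset of \<open>L\<close>.\<close>

lemma finite_homs:
  assumes A: "group A" "finite (carrier A)" and L: "comm_group L" "torsionwise_finite L"
  shows "finite (homs A L)"
proof -
  interpret A: group A by fact
  interpret L: comm_group L by fact
  have d: "0 < order A" using A(2) A.order_gt_0_iff_finite by simp
  have "f \<in> carrier A \<rightarrow>\<^sub>E {y \<in> carrier L. y [^]\<^bsub>L\<^esub> order A = \<one>\<^bsub>L\<^esub>}" if f: "f \<in> homs A L" for f
  proof (rule PiE_I)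
    fix x assume x: "x \<in> carrier A"
    have "f x [^]\<^bsub>L\<^esub> order A = f (x [^]\<^bsub>A\<^esub> order A)"
      using hom_nat_pow[OF homsD(4)[OF f] x A.is_group L.is_group] by simp
    also have "\<dots> = \<one>\<^bsub>L\<^esub>"
      using A.pow_order_eq_1[OF x] hom_one[OF homsD(4)[OF f] A.is_group L.is_group] by simp
    finally show "f x \<in> {y \<in> carrier L. y [^]\<^bsub>L\<^esub> order A = \<one>\<^bsub>L\<^esub>}" using homsD(1)[OF f x] by simp
  qed (use homsD(3)[OF f] in simp)
  then have "homs A L \<subseteq> carrier A \<rightarrow>\<^sub>E {y \<in> carrier L. y [^]\<^bsub>L\<^esub> order A = \<one>\<^bsub>L\<^esub>}" by blast
  moreover have "finite (carrier A \<rightarrow>\<^sub>E {y \<in> carrier L. y [^]\<^bsub>L\<^esub> order A = \<one>\<^bsub>L\<^esub>})"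
    using A(2) L(2) d by (intro finite_PiE) (auto simp: torsionwise_finite_def)
  ultimately show ?thesis by (rule finite_subset)
qed

section \<open>Rank\<close>

context comm_group
begin

text \<open>\<open>group_rank\<close> is a \<open>Max\<close>, which is informative only for a
  finite set of cardinalities. Bounds are therefore established in this form before the rank itself
  is touched.\<close>

definition indep_bounded :: "'a set \<Rightarrow> nat \<Rightarrow> bool" where
  "indep_bounded H n \<longleftrightarrow> (\<forall>Y. finite Y \<longrightarrow> Y \<subseteq> H \<longrightarrow> int_independent G Y \<longrightarrow> card Y \<le> n)"

lemma finprod_int_pow_const:
  assumes "a \<in> carrier G" "finite I"
  shows "(\<Otimes>y\<in>I. a [^] (k y :: int)) = a [^] (\<Sum>y\<in>I. k y)"
  using assms(2,1) by (induction I) (simp_all add: int_pow_mult Pi_def)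

text \<open>\<open>int_independent\<close> speaks of sets while the constructions below produce
  families. A repeated member would give a relation with coefficients 1 and -1, so an independent
  family is injective and its image has full cardinality.\<close>

lemma int_independent_image:
  assumes fin: "finite I" and z: "z ` I \<subseteq> carrier G"
    and ind: "\<forall>e::'i \<Rightarrow> int. (\<Otimes>y\<in>I. z y [^] e y) = \<one> \<longrightarrow> (\<forall>y\<in>I. e y = 0)"
  shows "inj_on z I" and "int_independent G (z ` I)"
proof -
  show inj: "inj_on z I"
  proof (rule inj_onI, rule ccontr)
    fix u v assume uv: "u \<in> I" "v \<in> I" "z u = z v" "u \<noteq> v"
    define e :: "'i \<Rightarrow> int" where "e y = (if y = u then 1 else if y = v then - 1 else 0)" for y
    have I: "I = insert u (insert v (I - {u, v}))" using uv by blast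
    have "(\<Otimes>y\<in>I. z y [^] e y) = (\<Otimes>y\<in>insert u (insert v (I - {u, v})). z y [^] e y)"
      using I by simp
    also have "\<dots> = z u [^] e u \<otimes> (z v [^] e v \<otimes> (\<Otimes>y\<in>I - {u, v}. z y [^] e y))"
      using fin z uv by (subst finprod_insert; (subst finprod_insert)?) (auto simp: Pi_def)
    also have "(\<Otimes>y\<in>I - {u, v}. z y [^] e y) = \<one>"
      by (rule finprod_one_eqI) (simp add: e_def)
    also have "z u [^] e u \<otimes> (z v [^] e v \<otimes> \<one>) = \<one>"
      using z uv by (auto simp: e_def int_pow_neg)
    finally have "\<forall>y\<in>I. e y = 0" using spec[OF ind, of e] by blast
    then show False using uv by (auto simp: e_def)
  qed
  show "int_independent G (z ` I)"
    unfolding int_independent_def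
  proof (intro allI impI)
    fix c :: "'a \<Rightarrow> int" assume c: "(\<Otimes>x\<in>z ` I. x [^] c x) = \<one>"
    have "(\<Otimes>x\<in>z ` I. x [^] c x) = (\<Otimes>y\<in>I. z y [^] c (z y))"
      using z by (intro finprod_reindex[OF _ inj]) auto
    then have "(\<Otimes>y\<in>I. z y [^] c (z y)) = \<one>" using c by simp
    then have "\<forall>y\<in>I. c (z y) = 0" using spec[OF ind, of "\<lambda>y. c (z y)"] by blast
    then show "\<forall>x\<in>z ` I. c x = 0" by blast
  qed
qed

text \<open>Elimination: pivot on an element whose exponent of \<open>a\<close> is nonzero and clear that exponent
  in the remaining elements, which then form an independent subset of \<open>H\<close>.\<close>
lemma indep_bounded_generate:
  assumes H: "subgroup H G" and a: "a \<in> carrier G" and bd: "indep_bounded H n"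
  shows "indep_bounded (H <#> range (\<lambda>z::int. a [^] z)) (Suc n)"
  unfolding indep_bounded_def
proof (intro allI impI)
  interpret H: subgroup H G by fact
  fix Y assume Y: "finite Y" "Y \<subseteq> H <#> range (\<lambda>z::int. a [^] z)" "int_independent G Y"
  have "\<forall>y\<in>Y. \<exists>h. \<exists>k::int. h \<in> H \<and> y = h \<otimes> a [^] k"
    using Y(2) mem_mult_powers_iff[of _ H a] by (metis subsetD)
  then obtain h and k :: "'a \<Rightarrow> int" where hk: "\<And>y. y \<in> Y \<Longrightarrow> h y \<in> H" "\<And>y. y \<in> Y \<Longrightarrow> y = h y \<otimes> a [^] k y"
    by metis
  have YG: "y \<in> carrier G" if "y \<in> Y" for y
    using hk(1)[OF that] a arg_cong[OF hk(2)[OF that], of "\<lambda>u. u \<in> carrier G"] by simp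
  show "card Y \<le> Suc n"
  proof (cases "\<forall>y\<in>Y. k y = 0")
    case True
    have "Y \<subseteq> H"
    proof
      fix y assume y: "y \<in> Y"
      then have "y = h y" using hk True H.mem_carrier[of "h y"] by (metis int_pow_0 r_one)
      then show "y \<in> H" using hk(1)[OF y] by simp
    qed
    then show ?thesis using bd Y unfolding indep_bounded_def by (metis le_SucI)
  next
    case False
    then obtain y0 where y0: "y0 \<in> Y" "k y0 \<noteq> 0" by blast
    define I where "I = Y - {y0}"
    have I: "finite I" "y0 \<notin> I" "Y = insert y0 I" using Y(1) y0(1) by (auto simp: I_def)
    have IG: "y \<in> carrier G" if "y \<in> I" for y using that YG I by blast
    have y0G: "y0 \<in> carrier G" using YG y0 by blast
    \<comment> \<open>The exponents of \<open>a\<close> in the two factors are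
      \<open>k y * k y0\<close> and \<open>- (k y0 * k y)\<close>, so they cancel.\<close>
    define z where "z y = y [^] k y0 \<otimes> y0 [^] (- k y)" for y
    have zH: "z y \<in> H" if "y \<in> I" for y
    proof -
      have y: "y \<in> Y" using that I by blast
      have hG: "h y \<in> carrier G" "h y0 \<in> carrier G" using hk(1) y y0(1) by auto
      have e1: "y [^] k y0 = h y [^] k y0 \<otimes> a [^] (k y * k y0)"
        using a hG hk(2)[OF y] by (metis int_pow_closed int_pow_distrib int_pow_pow)
      have e2: "y0 [^] (- k y) = h y0 [^] (- k y) \<otimes> a [^] (k y0 * (- k y))"
        using a hG hk(2)[OF y0(1)] by (metis int_pow_closed int_pow_distrib int_pow_pow)
      have e3: "a [^] (k y * k y0) \<otimes> a [^] (k y0 * (- k y)) = \<one>"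
        using a by (simp add: mult.commute flip: int_pow_mult)
      have mult4: "p \<otimes> q \<otimes> (r \<otimes> s) = p \<otimes> r \<otimes> (q \<otimes> s)"
        if "p \<in> carrier G" "q \<in> carrier G" "r \<in> carrier G" "s \<in> carrier G" for p q r s
        using that by (simp add: m_ac)
      have "z y = (h y [^] k y0 \<otimes> h y0 [^] (- k y)) \<otimes> (a [^] (k y * k y0) \<otimes> a [^] (k y0 * (- k y)))"
        unfolding z_def e1 e2 by (rule mult4) (use a hG in auto)
      then have "z y = h y [^] k y0 \<otimes> h y0 [^] (- k y)" unfolding e3 using hG by simp
      then show ?thesis
        using subgroup_int_pow_closed[OF H hk(1)[OF y], of "k y0"]
          subgroup_int_pow_closed[OF H hk(1)[OF y0(1)], of "- k y"] by simp
    qed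
    have ind: "\<forall>e::'a \<Rightarrow> int. (\<Otimes>y\<in>I. z y [^] e y) = \<one> \<longrightarrow> (\<forall>y\<in>I. e y = 0)"
    proof (intro allI impI)
      fix e :: "'a \<Rightarrow> int" assume e: "(\<Otimes>y\<in>I. z y [^] e y) = \<one>"
      \<comment> \<open>Expanding a relation among the \<open>z y\<close> gives a relation on
        \<open>Y\<close> with coefficient \<open>k y0 * e y\<close> at each \<open>y\<close> in
        \<open>I\<close> and the collected exponent \<open>S\<close> at the pivot. As
        \<open>k y0\<close> is nonzero, \<open>e\<close> vanishes.\<close>
      define S where "S = (\<Sum>y\<in>I. - k y * e y)"
      define c where "c y = (if y = y0 then S else k y0 * e y)" for y
      have cI: "c y = k y0 * e y" if "y \<in> I" for y using that I(2) by (auto simp: c_def)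
      have "(\<Otimes>y\<in>I. z y [^] e y) = (\<Otimes>y\<in>I. y [^] (k y0 * e y) \<otimes> y0 [^] (- k y * e y))"
        using IG y0G by (intro finprod_cong) (auto simp: z_def int_pow_distrib int_pow_pow Pi_def)
      also have "\<dots> = (\<Otimes>y\<in>I. y [^] (k y0 * e y)) \<otimes> (\<Otimes>y\<in>I. y0 [^] (- k y * e y))"
        using IG y0G by (intro finprod_multf) auto
      also have "(\<Otimes>y\<in>I. y0 [^] (- k y * e y)) = y0 [^] S"
        unfolding S_def using y0G I(1) by (rule finprod_int_pow_const)
      also have "(\<Otimes>y\<in>I. y [^] (k y0 * e y)) = (\<Otimes>y\<in>I. y [^] c y)"
        using IG by (intro finprod_cong) (auto simp: cI Pi_def)
      also have "\<dots> \<otimes> y0 [^] S = y0 [^] c y0 \<otimes> (\<Otimes>y\<in>I. y [^] c y)"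
        using IG y0G by (simp add: c_def m_comm Pi_def)
      also have "\<dots> = (\<Otimes>y\<in>Y. y [^] c y)"
        unfolding I(3) using IG y0G I by (subst finprod_insert) (auto simp: Pi_def)
      finally have "\<forall>y\<in>Y. c y = 0" using Y(3) e unfolding int_independent_def by simp
      then show "\<forall>y\<in>I. e y = 0" using y0(2) I(3) cI by simp
    qed
    have zG: "z ` I \<subseteq> carrier G" using zH H.mem_carrier by blast
    have "card (z ` I) \<le> n"
      using bd int_independent_image(2)[OF I(1) zG ind] zH I(1) unfolding indep_bounded_def
      by (simp add: image_subset_iff)
    then show ?thesis
      using card_image[OF int_independent_image(1)[OF I(1) zG ind]] I by simp
  qed
qed

lemma indep_bounded_one: "indep_bounded {\<one>} 0"
  unfolding indep_bounded_def
proof (intro allI impI)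
  fix Y assume Y: "finite Y" "Y \<subseteq> {\<one>}" "int_independent G Y"
  have "Y = {}"
  proof (rule ccontr)
    assume "Y \<noteq> {}"
    with Y(2) have "Y = {\<one>}" by blast
    then show False
      using Y(3) unfolding int_independent_def by (auto dest: spec[of _ "\<lambda>_. 1"])
  qed
  then show "card Y \<le> 0" by simp
qed

lemma indep_bounded_finite_generate:
  assumes "finite W" "W \<subseteq> carrier G"
  shows "indep_bounded (generate G W) (card W)"
  using assms
proof (induction W)
  case empty
  then show ?case by (simp add: generate_empty indep_bounded_one)
next
  case (insert a W)
  then show ?case
    using indep_bounded_generate[of "generate G W" a "card W"] generate_is_subgroup[of W]
    by (simp add: generate_insert)
qed

text \<open>A bound makes the set of cardinalities finite and the empty set makes it nonempty, so
  the maximum is attained.\<close>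

lemma group_rank_props:
  assumes "indep_bounded H n"
  shows "\<exists>Y. finite Y \<and> Y \<subseteq> H \<and> int_independent G Y \<and> card Y = group_rank G H"
    and "indep_bounded H (group_rank G H)"
proof -
  let ?R = "{card Y | Y. finite Y \<and> Y \<subseteq> H \<and> int_independent G Y}"
  have "?R \<subseteq> {..n}" using assms by (auto simp: indep_bounded_def)
  then have fin: "finite ?R" by (rule finite_subset) simp
  have "int_independent G {}" by (simp add: int_independent_def)
  then have "?R \<noteq> {}" by blast
  with fin have "group_rank G H \<in> ?R" unfolding group_rank_def by (rule Max_in)
  then show "\<exists>Y. finite Y \<and> Y \<subseteq> H \<and> int_independent G Y \<and> card Y = group_rank G H" by auto
  show "indep_bounded H (group_rank G H)"
    unfolding indep_bounded_def group_rank_def using fin by (auto intro!: Max_ge)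
qed

lemma group_rank_eqI:
  assumes "indep_bounded H n" "finite Y" "Y \<subseteq> H" "int_independent G Y" "card Y = n"
  shows "group_rank G H = n"
  using group_rank_props[OF assms(1)] assms unfolding indep_bounded_def
  by (metis le_antisym)

text \<open>A common power \<open>N\<close> moves all of a finite \<open>Y\<close> into
  \<open>H\<close>. The powers stay independent, since the coefficients are only multiplied by a
  nonzero \<open>N\<close>.\<close>

lemma indep_bounded_rad:
  assumes H: "subgroup H G" and bd: "indep_bounded H n"
  shows "indep_bounded (rad G H) n"
  unfolding indep_bounded_def
proof (intro allI impI)
  fix Y assume Y: "finite Y" "Y \<subseteq> rad G H" "int_independent G Y"
  have "\<exists>N::nat. 0 < N \<and> (\<forall>y\<in>Y. y [^] N \<in> H)"
    using Y(1,2)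
  proof (induction Y)
    case empty
    show ?case by auto
  next
    case (insert y Y)
    then obtain N :: nat where N: "0 < N" "\<forall>y\<in>Y. y [^] N \<in> H" by auto
    from insert.prems have y: "y \<in> rad G H" by simp
    then obtain m :: nat where m: "0 < m" "y [^] m \<in> H" by (rule radE)
    have mul: "x [^] (p * q) \<in> H" if "x [^] p \<in> H" "x \<in> carrier G" for x and p q :: nat
      using subgroup_nat_pow_closed[OF H that(1), of q] that(2) by (simp add: nat_pow_pow)
    have "x [^] (N * m) \<in> H" if "x \<in> insert y Y" for x
    proof -
      have x: "x \<in> carrier G" using that insert.prems rad_subset by blast
      show ?thesis
      proof (cases "x = y")
        case True
        then show ?thesis using mul[of y m N] m x by (simp add: mult.commute)
      next
        case False
        then show ?thesis using mul[of x N m] N x that by simp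
      qed
    qed
    then show ?case using N m by (intro exI[of _ "N * m"]) simp
  qed
  then obtain N :: nat where N: "0 < N" "\<forall>y\<in>Y. y [^] N \<in> H" by blast
  have YG: "Y \<subseteq> carrier G" using Y(2) rad_subset by blast
  define z where "z y = y [^] N" for y
  have ind: "\<forall>e::'a \<Rightarrow> int. (\<Otimes>y\<in>Y. z y [^] e y) = \<one> \<longrightarrow> (\<forall>y\<in>Y. e y = 0)"
  proof (intro allI impI)
    fix e :: "'a \<Rightarrow> int" assume e: "(\<Otimes>y\<in>Y. z y [^] e y) = \<one>"
    have pw: "z y [^] e y = y [^] (int N * e y)" if "y \<in> Y" for y
      using int_pow_pow[of y "int N" "e y"] that YG by (auto simp: z_def int_pow_int)
    have "(\<Otimes>y\<in>Y. z y [^] e y) = (\<Otimes>y\<in>Y. y [^] (int N * e y))"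
      using YG pw by (intro finprod_cong) (auto simp: Pi_def)
    then have "(\<Otimes>y\<in>Y. y [^] (int N * e y)) = \<one>" using e by simp
    then have "\<forall>y\<in>Y. int N * e y = 0"
      using spec[OF Y(3)[unfolded int_independent_def], of "\<lambda>y. int N * e y"] by blast
    then show "\<forall>y\<in>Y. e y = 0" using N(1) by simp
  qed
  have zG: "z ` Y \<subseteq> carrier G" using YG by (auto simp: z_def)
  have "z ` Y \<subseteq> H" using N by (auto simp: z_def)
  then have "card (z ` Y) \<le> n"
    using bd int_independent_image(2)[OF Y(1) zG ind] Y(1) unfolding indep_bounded_def by simp
  then show "card Y \<le> n" using card_image[OF int_independent_image(1)[OF Y(1) zG ind]] by simp
qed

lemma group_rank_between_rad:
  assumes H: "subgroup H G" and bd: "indep_bounded H n" and K: "H \<subseteq> K" "K \<subseteq> rad G H"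
  shows "group_rank G K = group_rank G H"
proof -
  have "indep_bounded (rad G H) (group_rank G H)"
    using indep_bounded_rad[OF H group_rank_props(2)[OF bd]] .
  then have "indep_bounded K (group_rank G H)"
    using K(2) unfolding indep_bounded_def by (meson subset_trans)
  then show ?thesis using group_rank_props(1)[OF bd] group_rank_eqI K(1) by (metis subset_trans)
qed

text \<open>Adjoin \<open>a\<close> to a maximal independent subset of \<open>H\<close>: a relation
  with nonzero coefficient at \<open>a\<close> would put a nonzero power of \<open>a\<close> into
  \<open>H\<close>. Elimination gives the matching upper bound.\<close>

lemma group_rank_new_generator:
  assumes H: "subgroup H G" and bd: "indep_bounded H n" and a: "a \<in> carrier G" "a \<notin> rad G H"
  shows "group_rank G (H <#> range (\<lambda>z::int. a [^] z)) = Suc (group_rank G H)"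
proof -
  interpret H: subgroup H G by fact
  obtain Y where Y: "finite Y" "Y \<subseteq> H" "int_independent G Y" "card Y = group_rank G H"
    using group_rank_props(1)[OF bd] by blast
  have aH: "a \<notin> H" using a subset_rad[OF H] by blast
  have aY: "a \<notin> Y" using aH Y by blast
  have YG: "y \<in> carrier G" if "y \<in> Y" for y using that Y(2) H.subset by blast
  have "int_independent G (insert a Y)"
    unfolding int_independent_def
  proof (intro allI impI)
    fix c :: "'a \<Rightarrow> int" assume c: "(\<Otimes>x\<in>insert a Y. x [^] c x) = \<one>"
    have eq: "a [^] c a \<otimes> (\<Otimes>x\<in>Y. x [^] c x) = \<one>"
      using c Y(1) aY a(1) YG by (simp add: Pi_def)
    have pG: "(\<Otimes>x\<in>Y. x [^] c x) \<in> carrier G" using YG by (intro finprod_closed) auto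
    have pH: "(\<Otimes>x\<in>Y. x [^] c x) \<in> H"
      using Y(1,2)
    proof (induction Y)
      case (insert y Y)
      then show ?case
        using subgroup_int_pow_closed[OF H, of y "c y"] H.subset
        by (subst finprod_insert) (auto simp: Pi_def)
    qed simp
    have "a [^] c a = inv (\<Otimes>x\<in>Y. x [^] c x)"
      using eq a(1) pG by (metis inv_equality int_pow_closed)
    then have "a [^] c a \<in> H" using pH by simp
    then have ca: "c a = 0" using rad_int_pow[OF H a(1)] a(2) by blast
    then have "(\<Otimes>x\<in>Y. x [^] c x) = \<one>" using eq pG by simp
    then show "\<forall>x\<in>insert a Y. c x = 0" using Y(3) ca unfolding int_independent_def by simp
  qed
  moreover have "insert a Y \<subseteq> H <#> range (\<lambda>z::int. a [^] z)"
  proof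
    fix y assume "y \<in> insert a Y"
    then consider "y = a" | "y \<in> Y" by blast
    then show "y \<in> H <#> range (\<lambda>z::int. a [^] z)"
    proof cases
      case 1
      then have "y = \<one> \<otimes> a [^] (1::int)" using a by simp
      then show ?thesis unfolding mem_mult_powers_iff using H.one_closed by metis
    next
      case 2
      then have "y = y \<otimes> a [^] (0::int)" "y \<in> H" using YG Y(2) by auto
      then show ?thesis unfolding mem_mult_powers_iff by metis
    qed
  qed
  moreover have "card (insert a Y) = Suc (group_rank G H)" using Y aY by simp
  ultimately show ?thesis
    using indep_bounded_generate[OF H a(1) group_rank_props(2)[OF bd]] Y(1)
    by (intro group_rank_eqI[of _ _ "insert a Y"]) auto
qed

end

section \<open>Counting tools\<close>

lemma (in group) card_dvd_of_subgroups:
  assumes "subgroup H G" "subgroup K G" "H \<subseteq> K"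
  shows "card H dvd card K"
  using group.card_subgroup_dvd[OF subgroup_imp_group[OF assms(2)] subgroup_incl[OF assms]] by simp

text \<open>Inclusion-exclusion. The sets \<open>E\<close> containing \<open>i\<close> repeat the
  sum with opposite sign over the elements having property \<open>i\<close>, which is why
  \<open>U\<close> must vary in the induction.\<close>

lemma sum_Pow_alternating_card:
  assumes "finite D" "finite U"
  shows "(\<Sum>E\<in>Pow D. (-1::int) ^ card E * int (card {x \<in> U. \<forall>i\<in>E. P x i}))
    = int (card {x \<in> U. \<forall>i\<in>D. \<not> P x i})"
  using assms
proof (induction D arbitrary: U)
  case (insert i D)
  have inj: "inj_on (insert i) (Pow D)" using insert.hyps by (auto simp: inj_on_def)
  let ?f = "\<lambda>V E. (-1::int) ^ card E * int (card {x \<in> V. \<forall>i\<in>E. P x i})"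
  let ?U = "{x \<in> U. P x i}"
  have "(\<Sum>E\<in>Pow (insert i D). ?f U E) = (\<Sum>E\<in>Pow D. ?f U E) + (\<Sum>E\<in>insert i ` Pow D. ?f U E)"
    unfolding Pow_insert using insert.hyps by (intro sum.union_disjoint) auto
  also have "(\<Sum>E\<in>insert i ` Pow D. ?f U E) = (\<Sum>E\<in>Pow D. ?f U (insert i E))"
    using inj by (simp add: sum.reindex)
  also have "\<dots> = (\<Sum>E\<in>Pow D. - ?f ?U E)"
  proof (rule sum.cong)
    fix E assume E: "E \<in> Pow D"
    then have "finite E" "i \<notin> E" using insert.hyps finite_subset by auto
    moreover have "{x \<in> U. \<forall>j\<in>insert i E. P x j} = {x \<in> ?U. \<forall>j\<in>E. P x j}" by auto
    ultimately show "?f U (insert i E) = - ?f ?U E" by simp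
  qed simp
  also have "(\<Sum>E\<in>Pow D. ?f U E) + (\<Sum>E\<in>Pow D. - ?f ?U E)
    = int (card {x \<in> U. \<forall>i\<in>D. \<not> P x i}) - int (card {x \<in> ?U. \<forall>i\<in>D. \<not> P x i})"
    using insert.IH[OF insert.prems] insert.IH[of ?U] insert.prems by (simp add: sum_negf)
  also have "{x \<in> U. \<forall>i\<in>D. \<not> P x i} = {x \<in> U. \<forall>j\<in>insert i D. \<not> P x j} \<union> {x \<in> ?U. \<forall>i\<in>D. \<not> P x i}"
    by auto
  also have "card \<dots> = card {x \<in> U. \<forall>j\<in>insert i D. \<not> P x j} + card {x \<in> ?U. \<forall>i\<in>D. \<not> P x i}"
    using insert.prems by (intro card_Un_disjoint) auto
  finally show ?case by simp
qed simp

definition torsion_part :: "('b,'n) monoid_scheme \<Rightarrow> nat \<Rightarrow> ('b,'n) monoid_scheme" where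
  "torsion_part L d = L\<lparr>carrier := {y \<in> carrier L. y [^]\<^bsub>L\<^esub> d = \<one>\<^bsub>L\<^esub>}\<rparr>"

lemma (in comm_group) comm_group_torsion_part: "comm_group (torsion_part G d)"
proof -
  have "subgroup {y \<in> carrier G. y [^] d = \<one>} G"
    by (rule subgroupI) (auto simp: nat_pow_inv nat_pow_distrib intro: exI[of _ \<one>])
  then show ?thesis unfolding torsion_part_def by (rule subgroup_imp_comm_group)
qed

text \<open>Homomorphisms out of \<open>I\<close> take values in the torsion of \<open>L\<close>
  killed by \<open>order Q\<close>, a finite group to which the symmetry applies. Using the order of
  \<open>Q\<close> and not that of \<open>I\<close> gives the same source group for all
  \<open>I\<close>, so the right-hand sides count subsets of one set.\<close>

lemma card_homs_subgroup_swap: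
  assumes Q: "comm_group Q" "finite (carrier Q)" and L: "comm_group L" "torsionwise_finite L"
    and I: "subgroup I Q"
  shows "card (homs (Q\<lparr>carrier := I\<rparr>) L)
    = card {f \<in> homs (torsion_part L (order Q)) Q. \<forall>y\<in>carrier (torsion_part L (order Q)). f y \<in> I}"
proof -
  interpret Q: comm_group Q by fact
  interpret L: comm_group L by fact
  let ?I = "Q\<lparr>carrier := I\<rparr>" and ?L = "torsion_part L (order Q)"
  have sub: "I \<subseteq> carrier Q" using I subgroup.subset by blast
  have cI: "comm_group ?I" using I by (rule Q.subgroup_imp_comm_group)
  then have gI: "group ?I" by (rule comm_group.axioms)
  have cL: "comm_group ?L" by (rule L.comm_group_torsion_part)
  have carL: "carrier ?L = {y \<in> carrier L. y [^]\<^bsub>L\<^esub> order Q = \<one>\<^bsub>L\<^esub>}" by (simp add: torsion_part_def)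
  have "0 < order Q" using Q(2) Q.order_gt_0_iff_finite by simp
  then have fL: "finite (carrier ?L)" using L(2) by (simp add: carL torsionwise_finite_def)
  have "homs ?I L = homs ?I ?L"
  proof
    show "homs ?I L \<subseteq> homs ?I ?L"
    proof
      fix f assume f: "f \<in> homs ?I L"
      show "f \<in> homs ?I ?L"
      proof (rule homsI)
        fix x assume x: "x \<in> carrier ?I"
        have "f x [^]\<^bsub>L\<^esub> order Q = f (x [^]\<^bsub>?I\<^esub> order Q)"
          using hom_nat_pow[OF homsD(4)[OF f] x gI L.is_group] by simp
        also have "x [^]\<^bsub>?I\<^esub> order Q = \<one>\<^bsub>Q\<^esub>"
          using Q.pow_order_eq_1[of x] x sub by (auto simp flip: Q.nat_pow_consistent)
        also have "f \<one>\<^bsub>Q\<^esub> = \<one>\<^bsub>L\<^esub>" using hom_one[OF homsD(4)[OF f] gI L.is_group] by simp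
        finally show "f x \<in> carrier ?L" using homsD(1)[OF f x] carL by simp
        fix y assume "y \<in> carrier ?I"
        then show "f (x \<otimes>\<^bsub>?I\<^esub> y) = f x \<otimes>\<^bsub>?L\<^esub> f y"
          using homsD(2)[OF f x] by (simp add: torsion_part_def)
      qed (use homsD(3)[OF f] in simp)
    qed
    show "homs ?I ?L \<subseteq> homs ?I L"
    proof
      fix f assume f: "f \<in> homs ?I ?L"
      show "f \<in> homs ?I L"
        using homsD(1,2,3)[OF f] by (intro homsI) (auto simp: carL torsion_part_def)
    qed
  qed
  also have "card (homs ?I ?L) = card (homs ?L ?I)"
    using card_homs_swap[OF cI _ cL fL] finite_subset[OF sub Q(2)] by simp
  also have "homs ?L ?I = {f \<in> homs ?L Q. \<forall>y\<in>carrier ?L. f y \<in> I}"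
    using sub by (auto simp: homs_def hom_def)
  finally show ?thesis .
qed

context comm_group
begin

lemma ann_generate:
  assumes K: "subgroup K G" and W: "W \<subseteq> K" and L: "comm_group L"
  shows "ann G L K (generate G W) = ann G L K W"
proof
  interpret L: comm_group L by fact
  interpret K: subgroup K G by fact
  have gK: "group (G\<lparr>carrier := K\<rparr>)" using K by (rule subgroup_imp_group)
  have WK: "generate G W \<subseteq> K" using W K by (rule generate_subgroup_incl)
  show "ann G L K (generate G W) \<subseteq> ann G L K W"
    by (auto simp: ann_def intro: generate.incl)
  show "ann G L K W \<subseteq> ann G L K (generate G W)"
  proof
    fix f assume "f \<in> ann G L K W"
    then have f: "f \<in> homs (G\<lparr>carrier := K\<rparr>) L" and f1: "\<And>w. w \<in> W \<Longrightarrow> f w = \<one>\<^bsub>L\<^esub>"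
      by (auto simp: ann_def)
    have "f h = \<one>\<^bsub>L\<^esub>" if "h \<in> generate G W" for h
      using that
    proof (induction h)
      case one
      then show ?case using hom_one[OF homsD(4)[OF f] gK L.is_group] by simp
    next
      case (incl h)
      then show ?case by (rule f1)
    next
      case (inv h)
      then show ?case
        using hom_subgroup_inv[OF L.is_group K homsD(4)[OF f], of h] f1[of h] W by auto
    next
      case (eng h1 h2)
      then have "h1 \<in> K" "h2 \<in> K" using WK by auto
      then show ?case using homsD(2)[OF f, of h1 h2] eng by simp
    qed
    then show "f \<in> ann G L K (generate G W)" using f by (simp add: ann_def)
  qed
qed

lemma subgroup_ann:
  assumes "subgroup K G" "H \<subseteq> K" "comm_group L"
  shows "subgroup (ann G L K H) (hom_grp (G\<lparr>carrier := K\<rparr>) L)"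
proof -
  interpret L: comm_group L by fact
  show ?thesis
    unfolding ann_def
    using assms L.triv_subgroup
    by (intro subgroup_homs_constrained subgroup_imp_group) auto
qed

text \<open>The first isomorphism theorem for restriction to \<open>R\<close>, taken on a subgroup
  \<open>P\<close> so that it can be compared for two different annihilators.\<close>

lemma card_restriction_fibers:
  assumes R: "subgroup R G" and R': "subgroup R' G" and sub: "R \<subseteq> R'" and L: "comm_group L"
    and P: "subgroup P (hom_grp (G\<lparr>carrier := R'\<rparr>) L)"
  shows "card P = card ((\<lambda>f. restrict f R) ` P) * card {f \<in> P. \<forall>x\<in>R. f x = \<one>\<^bsub>L\<^esub>}"
proof -
  interpret L: comm_group L by fact
  let ?A = "G\<lparr>carrier := R\<rparr>" and ?A' = "G\<lparr>carrier := R'\<rparr>"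
  have gA: "group ?A" "group ?A'" using R R' subgroup_imp_group by auto
  interpret HA: comm_group "hom_grp ?A L" using gA(1) L by (rule comm_group_hom_grp)
  interpret HA': comm_group "hom_grp ?A' L" using gA(2) L by (rule comm_group_hom_grp)
  have PA: "f \<in> homs ?A' L" if "f \<in> P" for f using subgroup.mem_carrier[OF P that] by (simp add: hom_grp_def)
  interpret \<rho>: group_hom "hom_grp ?A' L\<lparr>carrier := P\<rparr>" "hom_grp ?A L" "\<lambda>f. restrict f R"
  proof (unfold group_hom_def group_hom_axioms_def, intro conjI)
    show "group (hom_grp ?A' L\<lparr>carrier := P\<rparr>)" using P by (rule HA'.subgroup_imp_group)
    show "group (hom_grp ?A L)" by (rule HA.is_group)
    show "(\<lambda>f. restrict f R) \<in> hom (hom_grp ?A' L\<lparr>carrier := P\<rparr>) (hom_grp ?A L)"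
    proof (rule homI)
      fix f assume "f \<in> carrier (hom_grp ?A' L\<lparr>carrier := P\<rparr>)"
      then have f: "f \<in> homs ?A' L" using PA by simp
      have "restrict f R \<in> homs ?A L"
        using homsD(1,2)[OF f] sub subgroup.m_closed[OF R] by (intro homsI) (auto simp: subset_iff)
      then show "restrict f R \<in> carrier (hom_grp ?A L)" by (simp add: hom_grp_def)
    next
      fix f g
      show "restrict (f \<otimes>\<^bsub>hom_grp ?A' L\<lparr>carrier := P\<rparr>\<^esub> g) R
        = restrict f R \<otimes>\<^bsub>hom_grp ?A L\<^esub> restrict g R"
        using sub by (auto simp: hom_grp_def fun_eq_iff)
    qed
  qed
  have "kernel (hom_grp ?A' L\<lparr>carrier := P\<rparr>) (hom_grp ?A L) (\<lambda>f. restrict f R) = {f \<in> P. \<forall>x\<in>R. f x = \<one>\<^bsub>L\<^esub>}"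
    by (auto simp: kernel_def hom_grp_def fun_eq_iff restrict_def split: if_splits)
  then show ?thesis using \<rho>.card_image_times_kernel by simp
qed

end

section \<open>Multiplicities of a list in a finitely generated abelian group\<close>

locale arrangement = comm_group G for G (structure) +
  fixes A :: "'a list"
  assumes fin_gen: "fin_gen_group G" and A_closed: "set A \<subseteq> carrier G"
begin

abbreviation span where "span S \<equiv> span_sub G A S"

lemma nth_closed: "i < length A \<Longrightarrow> A ! i \<in> carrier G"
  using A_closed nth_mem by blast

lemma gens_closed: "S \<subseteq> {..<length A} \<Longrightarrow> (\<lambda>i. A ! i) ` S \<subseteq> carrier G"
  using nth_closed by blast

lemma subgroup_span: "S \<subseteq> {..<length A} \<Longrightarrow> subgroup (span S) G"
  unfolding span_sub_def by (intro generate_is_subgroup gens_closed)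

lemma span_mono: "S \<subseteq> T \<Longrightarrow> span S \<subseteq> span T"
  unfolding span_sub_def by (intro mono_generate) auto

lemma nth_in_span: "i \<in> S \<Longrightarrow> A ! i \<in> span S"
  unfolding span_sub_def by (rule generate.incl) simp

lemma span_subset:
  assumes "subgroup K G" "\<And>i. i \<in> S \<Longrightarrow> A ! i \<in> K"
  shows "span S \<subseteq> K"
  unfolding span_sub_def using assms by (intro generate_subgroup_incl) auto

lemma span_insert:
  assumes "S \<subseteq> {..<length A}" "i < length A"
  shows "span (insert i S) = span S <#> range (\<lambda>z::int. (A ! i) [^] z)"
  unfolding span_sub_def using generate_insert[OF gens_closed nth_closed] assms by simp

lemma span_insertE:
  assumes "x \<in> span (insert i S)" "S \<subseteq> {..<length A}" "i < length A"
  obtains v and k :: int where "v \<in> span S" "x = v \<otimes> (A ! i) [^] k"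
  using assms(1) unfolding span_insert[OF assms(2,3)] mem_mult_powers_iff by (elim bexE exE) (rule that)

section \<open>Ranks and radicals of spans\<close>

lemma indep_bounded_span:
  assumes "S \<subseteq> {..<length A}"
  shows "indep_bounded (span S) (card ((\<lambda>i. A ! i) ` S))"
  unfolding span_sub_def
  using assms finite_subset[OF assms] by (intro indep_bounded_finite_generate gens_closed) auto

text \<open>With its counterpart for generators outside the radical, this carries all later
  reasoning about \<open>r_sub\<close>.\<close>

lemma r_insert_dependent:
  assumes S: "S \<subseteq> {..<length A}" and i: "A ! i \<in> rad G (span S)"
  shows "r_sub G A (insert i S) = r_sub G A S"
proof -
  have "span (insert i S) \<subseteq> rad G (span S)"
    using i nth_in_span subset_rad[OF subgroup_span[OF S]]
    by (intro span_subset rad_subgroup subgroup_span[OF S]) auto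
  then show ?thesis
    unfolding r_sub_def
    using span_mono[of S "insert i S"]
    by (intro group_rank_between_rad[OF subgroup_span[OF S] indep_bounded_span[OF S]]) auto
qed

lemma r_insert_independent:
  assumes "S \<subseteq> {..<length A}" "i < length A" "A ! i \<notin> rad G (span S)"
  shows "r_sub G A (insert i S) = Suc (r_sub G A S)"
  unfolding r_sub_def span_insert[OF assms(1,2)]
  using group_rank_new_generator[OF subgroup_span indep_bounded_span nth_closed] assms by blast

lemma r_union_bounds:
  assumes "finite D" "S \<union> D \<subseteq> {..<length A}"
  shows "r_sub G A S \<le> r_sub G A (S \<union> D) \<and> r_sub G A (S \<union> D) \<le> r_sub G A S + card D"
  using assms
proof (induction D)
  case (insert i D)
  then have "r_sub G A (insert i (S \<union> D)) = r_sub G A (S \<union> D)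
    \<or> r_sub G A (insert i (S \<union> D)) = Suc (r_sub G A (S \<union> D))"
    using r_insert_dependent[of "S \<union> D" i] r_insert_independent[of "S \<union> D" i] by auto
  then show ?case using insert by auto
qed simp

lemma r_bounds:
  assumes "S \<subseteq> T" "T \<subseteq> {..<length A}"
  shows "r_sub G A S \<le> r_sub G A T" and "r_sub G A T \<le> r_sub G A S + card (T - S)"
proof -
  have "S \<union> (T - S) = T" using assms by blast
  moreover have "finite (T - S)" using finite_subset[OF assms(2)] by simp
  ultimately show "r_sub G A S \<le> r_sub G A T" "r_sub G A T \<le> r_sub G A S + card (T - S)"
    using r_union_bounds[of "T - S" S] assms by auto
qed

text \<open>A generator from \<open>T\<close> outside the radical of \<open>span S\<close> would
  already raise the rank by one.\<close>

lemma rad_span_eq: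
  assumes T: "S \<subseteq> T" "T \<subseteq> {..<length A}" and r: "r_sub G A S = r_sub G A T"
  shows "rad G (span T) = rad G (span S)"
proof
  have S: "S \<subseteq> {..<length A}" using T by blast
  show "rad G (span S) \<subseteq> rad G (span T)" using T by (intro rad_mono span_mono)
  have "A ! i \<in> rad G (span S)" if i: "i \<in> T" for i
  proof (rule ccontr)
    assume "A ! i \<notin> rad G (span S)"
    then have "r_sub G A (insert i S) = Suc (r_sub G A S)"
      using r_insert_independent[OF S] i T by auto
    moreover have "r_sub G A (insert i S) \<le> r_sub G A T" using i T by (intro r_bounds) auto
    ultimately show False using r by simp
  qed
  then show "rad G (span T) \<subseteq> rad G (span S)"
    by (intro rad_rad span_subset rad_subgroup subgroup_span[OF S])
qed

section \<open>Independence of generators modulo a span\<close>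

definition independent_over where
  "independent_over S T \<longleftrightarrow> (\<forall>B i. S \<subseteq> B \<and> B \<subseteq> T \<and> i \<in> T - B \<longrightarrow> A ! i \<notin> rad G (span B))"

lemma independent_overD:
  assumes "independent_over S T" "S \<subseteq> B" "B \<subseteq> T" "i \<in> T" "i \<notin> B"
  shows "A ! i \<notin> rad G (span B)"
  using assms unfolding independent_over_def by simp

text \<open>Each index of \<open>T - S\<close> raises the rank by at most one. Reaching the full
  total leaves no room for a step that raises it by zero, in whatever order the indices are
  added.\<close>

lemma independent_overI:
  assumes T: "S \<subseteq> T" "T \<subseteq> {..<length A}" and r: "r_sub G A T = r_sub G A S + card (T - S)"
  shows "independent_over S T"
  unfolding independent_over_def
proof (intro allI impI notI)
  fix B i assume B: "S \<subseteq> B \<and> B \<subseteq> T \<and> i \<in> T - B" and i: "A ! i \<in> rad G (span B)"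
  then have "r_sub G A (insert i B) = r_sub G A B" using T by (intro r_insert_dependent) auto
  moreover have "r_sub G A B \<le> r_sub G A S + card (B - S)" using B T by (intro r_bounds) auto
  moreover have "r_sub G A T \<le> r_sub G A (insert i B) + card (T - insert i B)"
    using B T by (intro r_bounds) auto
  moreover have "card (T - S) = card (B - S) + (card (T - insert i B) + 1)"
  proof -
    have fin: "finite T" using T finite_subset by auto
    have "T - S = (B - S) \<union> insert i (T - insert i B)" using B by auto
    then have "card (T - S) = card (B - S) + card (insert i (T - insert i B))"
      using fin B finite_subset by (simp only:) (intro card_Un_disjoint; auto intro: finite_subset)
    then show ?thesis using fin by simp
  qed
  ultimately show False using r by simp
qed

lemma span_pow_mult:
  assumes "x = v \<otimes> a [^] (k::int)" "v \<in> carrier G" "a \<in> carrier G"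
  shows "x [^] (n::nat) = v [^] n \<otimes> a [^] (k * int n)"
  using assms int_pow_pow[of a k "int n"] by (simp add: nat_pow_distrib int_pow_int)

text \<open>Modulo \<open>span B\<close> the remaining generators are free, so their span meets the
  torsion trivially. In the induction step a power of \<open>x\<close> in \<open>span B\<close>
  yields a power of the last generator in the span of the others, so its exponent is zero.\<close>

lemma rad_span_Int_union:
  assumes ind: "independent_over S T" and T: "T \<subseteq> {..<length A}" and B: "S \<subseteq> B"
    and D: "finite D" "B \<union> D \<subseteq> T"
  shows "rad G (span B) \<inter> span (B \<union> D) \<subseteq> span B"
  using D
proof (induction D)
  case (insert i D)
  let ?D = "B \<union> D"
  show ?case
  proof (cases "i \<in> ?D")
    case True
    then show ?thesis using insert by (simp add: insert_absorb)
  next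
    case False
    have DA: "?D \<subseteq> {..<length A}" and BA: "B \<subseteq> {..<length A}" and iA: "i < length A"
      using insert.prems T by auto
    have ai: "A ! i \<notin> rad G (span ?D)"
      using B insert.prems False by (intro independent_overD[OF ind]) auto
    note sD = subgroup_span[OF DA]
    show ?thesis
    proof
      fix x assume x: "x \<in> rad G (span B) \<inter> span (B \<union> insert i D)"
      then have "x \<in> span (insert i ?D)" by simp
      then obtain v and k :: int where v: "v \<in> span ?D" and xv: "x = v \<otimes> (A ! i) [^] k"
        using DA iA by (rule span_insertE)
      have vG: "v \<in> carrier G" using v sD subgroup.mem_carrier by metis
      have xG: "x \<in> carrier G" using x rad_subset by blast
      from x have "x \<in> rad G (span B)" by simp
      then obtain n :: nat where n: "0 < n" "x [^] n \<in> span B" by (rule radE)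
      have "x [^] n = v [^] n \<otimes> (A ! i) [^] (k * int n)"
        using xv vG nth_closed[OF iA] by (rule span_pow_mult)
      then have eq: "(A ! i) [^] (k * int n) = inv (v [^] n) \<otimes> x [^] n"
        by (subst inv_solve_left) (use vG xG nth_closed[OF iA] in auto)
      have "x [^] n \<in> span ?D" using n(2) span_mono[of B ?D] by blast
      then have "(A ! i) [^] (k * int n) \<in> span ?D"
        unfolding eq using subgroup_nat_pow_closed[OF sD v] subgroup.m_closed[OF sD] subgroup.m_inv_closed[OF sD]
        by simp
      then have "k * int n = 0" using rad_int_pow[OF sD nth_closed[OF iA]] ai by blast
      then have "x = v" using n xv vG by simp
      then show "x \<in> span B" using v x insert.IH insert.prems by auto
    qed
  qed
qed simp

text \<open>This is the injectivity of the map from the torsion modulo \<open>span B\<close> to the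
  quotient by \<open>span T\<close>.\<close>

lemma rad_span_Int_span:
  assumes "independent_over S T" "T \<subseteq> {..<length A}" "S \<subseteq> B" "B \<subseteq> T"
  shows "rad G (span B) \<inter> span T = span B"
proof
  have "B \<union> (T - B) = T" using assms by blast
  moreover have "finite (T - B)" using finite_subset[OF assms(2)] by simp
  ultimately show "rad G (span B) \<inter> span T \<subseteq> span B"
    using rad_span_Int_union[OF assms(1,2,3), of "T - B"] by simp
  have "subgroup (span B) G" using assms by (intro subgroup_span) auto
  then show "span B \<subseteq> rad G (span B) \<inter> span T"
    using span_mono[OF assms(4)] subset_rad by blast
qed

section \<open>The subgroups \<open>I(B)\<close> of the torsion of the quotient by
  \<open>span T\<close>\<close>

definition tor_image where
  "tor_image T B = (\<lambda>x. span T #> x) ` rad G (span B)"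

lemma tor_image_mono: "B \<subseteq> C \<Longrightarrow> tor_image T B \<subseteq> tor_image T C"
  unfolding tor_image_def by (intro image_mono rad_mono span_mono)

text \<open>Dividing an element of \<open>rad \<langle>B\<rangle>\<close> by a suitable power of the \<open>i\<close>-th generator moves it into
  \<open>rad \<langle>B - {i}\<rangle>\<close>: its \<open>i\<close>-th rational coordinate is integral because its class also comes
  from \<open>rad \<langle>T - {i}\<rangle>\<close>.\<close>
lemma tor_image_Int:
  assumes ind: "independent_over S T" and T: "T \<subseteq> {..<length A}" and B: "S \<subseteq> B" "B \<subseteq> T"
    and i: "i \<in> B - S"
  shows "tor_image T B \<inter> tor_image T (T - {i}) \<subseteq> tor_image T (B - {i})"
proof
  have iT: "i \<in> T" and iA: "i < length A" using i B T by auto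
  define a where "a = A ! i"
  have a: "a \<in> carrier G" using nth_closed[OF iA] by (simp add: a_def)
  have subs: "T - {i} \<subseteq> {..<length A}" "B - {i} \<subseteq> {..<length A}" using B T by auto
  note sT = subgroup_span[OF T] and sB' = subgroup_span[OF subs(2)]
  note sR = rad_subgroup[OF subgroup_span[OF subs(1)]]
  have ai: "a \<notin> rad G (span (T - {i}))"
    unfolding a_def using B i iT by (intro independent_overD[OF ind]) auto
  fix q assume q: "q \<in> tor_image T B \<inter> tor_image T (T - {i})"
  then obtain b c where b: "b \<in> rad G (span B)" "q = span T #> b"
    and c: "c \<in> rad G (span (T - {i}))" "span T #> b = span T #> c"
    by (auto simp: tor_image_def)
  have bG: "b \<in> carrier G" and cG: "c \<in> carrier G" using b c rad_subset by blast+
  from b(1) obtain n :: nat where n: "0 < n" "b [^] n \<in> span B" by (rule radE)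
  have "insert i (B - {i}) = B" "insert i (T - {i}) = T" using i iT by auto
  then have ins: "span B = span (insert i (B - {i}))" "span T = span (insert i (T - {i}))" by simp_all
  have "b [^] n \<in> span (insert i (B - {i}))" using n(2) ins(1) by simp
  then obtain u and k :: int where u: "u \<in> span (B - {i})" and bu: "b [^] n = u \<otimes> a [^] k"
    unfolding a_def using subs(2) iA by (rule span_insertE)
  have "b \<otimes> inv c \<in> span (insert i (T - {i}))"
    using rcoset_eq_iff[OF sT bG cG] c(2) ins(2) by simp
  then obtain v and l :: int where v: "v \<in> span (T - {i})" and bv: "b \<otimes> inv c = v \<otimes> a [^] l"
    unfolding a_def using subs(1) iA by (rule span_insertE)
  have uG: "u \<in> carrier G" using u sB' subgroup.mem_carrier by metis
  have vR: "v \<in> rad G (span (T - {i}))" using v subset_rad[OF subgroup_span[OF subs(1)]] by blast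
  have vG: "v \<in> carrier G" using vR rad_subset by blast
  have uR: "u \<in> rad G (span (T - {i}))"
    using u span_mono[of "B - {i}" "T - {i}"] B(2) subset_rad[OF subgroup_span[OF subs(1)]] by blast
  have "b = (b \<otimes> inv c) \<otimes> c" using bG cG by (simp add: m_assoc)
  also have "\<dots> = (v \<otimes> c) \<otimes> a [^] l" unfolding bv using vG cG a by (simp add: m_ac)
  finally have "b [^] n = (v \<otimes> c) [^] n \<otimes> a [^] (l * int n)"
    using vG cG a by (intro span_pow_mult) auto
  then have "u \<otimes> a [^] k = (v \<otimes> c) [^] n \<otimes> a [^] (l * int n)" using bu by simp
  moreover have "a [^] k = a [^] (k - l * int n) \<otimes> a [^] (l * int n)"
    using a by (simp flip: int_pow_mult)
  ultimately have "(u \<otimes> a [^] (k - l * int n)) \<otimes> a [^] (l * int n) = (v \<otimes> c) [^] n \<otimes> a [^] (l * int n)"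
    using uG a by (simp add: m_assoc)
  then have "u \<otimes> a [^] (k - l * int n) = (v \<otimes> c) [^] n"
    using uG a vG cG by simp
  then have eq: "a [^] (k - l * int n) = inv u \<otimes> (v \<otimes> c) [^] n"
    by (subst inv_solve_left) (use uG vG cG a in auto)
  have "a [^] (k - l * int n) \<in> rad G (span (T - {i}))"
    unfolding eq
    by (intro subgroup.m_closed[OF sR] subgroup.m_inv_closed[OF sR] subgroup_nat_pow_closed[OF sR] uR vR c(1))
  \<comment> \<open>The rational coordinate of \<open>b\<close> at \<open>i\<close> is
    \<open>k / n\<close>; outside the radical no nonzero power of \<open>a\<close> is allowed, so it
    equals the integer \<open>l\<close>.\<close>
  then have "k - l * int n = 0"
    using rad_int_pow[OF sR a] rad_rad[OF subset_refl, of "span (T - {i})"] ai by blast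
  then have k: "k = l * int n" by simp
  define x where "x = b \<otimes> a [^] (- l)"
  have "x [^] n = b [^] n \<otimes> a [^] (- l * int n)"
    using x_def bG a by (rule span_pow_mult)
  also have "\<dots> = u \<otimes> (a [^] k \<otimes> a [^] (- l * int n))" unfolding bu using uG a by (simp add: m_assoc)
  also have "a [^] k \<otimes> a [^] (- l * int n) = \<one>" unfolding k using a by (simp flip: int_pow_mult)
  finally have "x [^] n \<in> span (B - {i})" using u uG by simp
  moreover have xG: "x \<in> carrier G" using bG a by (simp add: x_def)
  ultimately have x: "x \<in> rad G (span (B - {i}))" using n(1) by (auto simp: rad_def)
  have "b \<otimes> inv x = a [^] l"
    unfolding x_def using bG a by (simp add: inv_mult int_pow_neg flip: m_assoc)
  also have "\<dots> \<in> span T"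
    unfolding a_def by (intro subgroup_int_pow_closed[OF sT] nth_in_span iT)
  finally have "q = span T #> x" using b(2) rcoset_eq_iff[OF sT bG xG] by simp
  then show "q \<in> tor_image T (B - {i})" using x by (auto simp: tor_image_def)
qed

text \<open>Removing indices one by one turns membership into a conjunction of conditions on single
  indices, the shape required by inclusion-exclusion.\<close>

lemma tor_image_Diff_iff:
  assumes ind: "independent_over S T" and T: "T \<subseteq> {..<length A}" and S: "S \<subseteq> T"
    and E: "finite E" "E \<subseteq> T - S" and q: "q \<in> tor_image T T"
  shows "q \<in> tor_image T (T - E) \<longleftrightarrow> (\<forall>i\<in>E. q \<in> tor_image T (T - {i}))"
  using E
proof (induction E)
  case empty
  then show ?case using q by simp
next
  case (insert i E)
  have eq: "T - insert i E = (T - E) - {i}" by blast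
  have "q \<in> tor_image T (T - insert i E) \<longleftrightarrow> q \<in> tor_image T (T - E) \<and> q \<in> tor_image T (T - {i})"
  proof
    show "q \<in> tor_image T (T - insert i E) \<Longrightarrow> q \<in> tor_image T (T - E) \<and> q \<in> tor_image T (T - {i})"
      using tor_image_mono[of "T - insert i E" "T - E" T] tor_image_mono[of "T - insert i E" "T - {i}" T] by blast
    show "q \<in> tor_image T (T - E) \<and> q \<in> tor_image T (T - {i}) \<Longrightarrow> q \<in> tor_image T (T - insert i E)"
      unfolding eq using tor_image_Int[OF ind T, of "T - E" i] insert.hyps insert.prems S by blast
  qed
  then show ?case using insert by (simp add: conj_commute)
qed

section \<open>Multiplicities as counts of homomorphisms\<close>

lemma m_count_eq:
  assumes S: "S \<subseteq> {..<length A}" and L: "comm_group L"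
  shows "m_count G A S L = card (ann G L (rad G (span S)) (span S))"
proof -
  note s = subgroup_span[OF S]
  have "rad G (span S) \<inter> span S = span S" using subset_rad[OF s] by blast
  then show ?thesis
    using card_homs_quotient[OF s rad_subgroup[OF s] L] torsion_subgroup_Mod[OF s]
    by (simp add: m_count_def Let_def homs_def)
qed

lemma comm_group_torsion:
  assumes T: "T \<subseteq> {..<length A}"
  shows "comm_group (torsion_subgroup (G Mod span T))" "finite (carrier (torsion_subgroup (G Mod span T)))"
proof -
  note s = subgroup_span[OF T]
  interpret N: normal "span T" G using s by (rule subgroup_imp_normal)
  interpret Q: comm_group "G Mod span T" using s by (rule abelian_FactGroup)
  interpret p: group_hom G "G Mod span T" "\<lambda>x. span T #> x"
    using N.r_coset_hom_Mod Q.is_group by (simp add: group_hom_def group_hom_axioms_def)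
  show "comm_group (torsion_subgroup (G Mod span T))"
    unfolding torsion_subgroup_Mod[OF s]
    by (rule Q.subgroup_imp_comm_group) (rule p.subgroup_img_is_subgroup[OF rad_subgroup[OF s]])
  show "finite (carrier (torsion_subgroup (G Mod span T)))"
    unfolding torsion_subgroup_Mod[OF s] using finite_torsion_quotient[OF s fin_gen] by simp
qed

lemma subgroup_tor_image:
  assumes T: "T \<subseteq> {..<length A}" and B: "B \<subseteq> T"
  shows "subgroup (tor_image T B) (torsion_subgroup (G Mod span T))"
proof -
  note s = subgroup_span[OF T]
  have sB: "subgroup (span B) G" using T B by (intro subgroup_span) auto
  interpret N: normal "span T" G using s by (rule subgroup_imp_normal)
  interpret Q: comm_group "G Mod span T" using s by (rule abelian_FactGroup)
  interpret p: group_hom G "G Mod span T" "\<lambda>x. span T #> x"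
    using N.r_coset_hom_Mod Q.is_group by (simp add: group_hom_def group_hom_axioms_def)
  show ?thesis
    unfolding torsion_subgroup_Mod[OF s]
    using tor_image_mono[OF B, of T] sB s unfolding tor_image_def
    by (intro Q.subgroup_incl p.subgroup_img_is_subgroup rad_subgroup)
qed

lemma carrier_torsion:
  "T \<subseteq> {..<length A} \<Longrightarrow> carrier (torsion_subgroup (G Mod span T)) = tor_image T T"
  by (simp add: torsion_subgroup_Mod subgroup_span tor_image_def)

text \<open>The ambient finite set, depending on \<open>T\<close> only, in which the multiplicities
  of all \<open>B\<close> between \<open>S\<close> and \<open>T\<close> are counted.\<close>

definition dual_homs where
  "dual_homs L T = homs (torsion_part L (order (torsion_subgroup (G Mod span T)))) (torsion_subgroup (G Mod span T))"

definition tor_carrier where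
  "tor_carrier L T = carrier (torsion_part L (order (torsion_subgroup (G Mod span T))))"

text \<open>By independence \<open>span B\<close> is \<open>rad G (span B) \<inter> span T\<close>,
  so the homomorphisms counted live on the subgroup \<open>tor_image T B\<close> of the torsion
  modulo \<open>span T\<close>; then the arguments of Hom are exchanged.\<close>

lemma m_count_dual:
  assumes ind: "independent_over S T" and T: "T \<subseteq> {..<length A}" and B: "S \<subseteq> B" "B \<subseteq> T"
    and L: "comm_group L" "torsionwise_finite L"
  shows "m_count G A B L = card {f \<in> dual_homs L T. \<forall>y\<in>tor_carrier L T. f y \<in> tor_image T B}"
proof -
  note s = subgroup_span[OF T]
  have BA: "B \<subseteq> {..<length A}" using B T by blast
  let ?Q = "torsion_subgroup (G Mod span T)"
  have "m_count G A B L = card (ann G L (rad G (span B)) (rad G (span B) \<inter> span T))"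
    using m_count_eq[OF BA L(1)] rad_span_Int_span[OF ind T B] by simp
  also have "\<dots> = card (homs ((G Mod span T)\<lparr>carrier := tor_image T B\<rparr>) L)"
    unfolding tor_image_def by (rule card_homs_quotient[OF s rad_subgroup[OF subgroup_span[OF BA]] L(1), symmetric])
  also have "(G Mod span T)\<lparr>carrier := tor_image T B\<rparr> = ?Q\<lparr>carrier := tor_image T B\<rparr>"
    by (simp add: torsion_subgroup_def)
  also have "card (homs \<dots> L) = card {f \<in> dual_homs L T. \<forall>y\<in>tor_carrier L T. f y \<in> tor_image T B}"
    unfolding dual_homs_def tor_carrier_def
    by (rule card_homs_subgroup_swap[OF comm_group_torsion[OF T] L subgroup_tor_image[OF T B(2)]])
  finally show ?thesis .
qed

lemma dual_homs_closed:
  assumes "T \<subseteq> {..<length A}" "f \<in> dual_homs L T" "y \<in> tor_carrier L T"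
  shows "f y \<in> tor_image T T"
  using homsD(1)[of f _ _ y] assms carrier_torsion[OF assms(1)] unfolding dual_homs_def tor_carrier_def by metis

lemma finite_dual_homs:
  assumes T: "T \<subseteq> {..<length A}" and L: "comm_group L" "torsionwise_finite L"
  shows "finite (dual_homs L T)"
proof -
  interpret Q: comm_group "torsion_subgroup (G Mod span T)" using comm_group_torsion[OF T] by simp
  have "0 < order (torsion_subgroup (G Mod span T))"
    using comm_group_torsion(2)[OF T] Q.order_gt_0_iff_finite by simp
  then have "finite (tor_carrier L T)"
    using L(2) by (simp add: tor_carrier_def torsion_part_def torsionwise_finite_def)
  then have "finite (tor_carrier L T \<rightarrow>\<^sub>E tor_image T T)"
    using comm_group_torsion(2)[OF T] carrier_torsion[OF T] by (intro finite_PiE) auto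
  moreover have "dual_homs L T \<subseteq> tor_carrier L T \<rightarrow>\<^sub>E tor_image T T"
  proof (intro subsetI PiE_I)
    fix f y assume f: "f \<in> dual_homs L T"
    show "f y \<in> tor_image T T" if "y \<in> tor_carrier L T" using dual_homs_closed[OF T f that] .
    show "f y = undefined" if "y \<notin> tor_carrier L T"
      using homsD(3)[OF f[unfolded dual_homs_def]] that unfolding tor_carrier_def .
  qed
  ultimately show ?thesis using finite_subset by blast
qed

end

section \<open>Divisibility and positivity\<close>

context arrangement
begin

lemma m_count_dvd_dependent:
  assumes S: "S \<subseteq> {..<length A}" and a: "a < length A"
    and r: "r_sub G A (insert a S) = r_sub G A S" and L: "comm_group L"
  shows "m_count G A (insert a S) L dvd m_count G A S L"
proof -
  let ?R = "rad G (span S)"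
  have aS: "insert a S \<subseteq> {..<length A}" using S a by simp
  have R: "rad G (span (insert a S)) = ?R" using rad_span_eq[OF _ aS] r by auto
  have sR: "subgroup ?R G" by (rule rad_subgroup[OF subgroup_span[OF S]])
  have sub: "span (insert a S) \<subseteq> ?R" using subset_rad[OF subgroup_span[OF aS]] R by simp
  interpret H: comm_group "hom_grp (G\<lparr>carrier := ?R\<rparr>) L"
    using subgroup_imp_group[OF sR] L by (rule comm_group_hom_grp)
  have "span S \<subseteq> span (insert a S)" by (rule span_mono) auto
  then show ?thesis
    unfolding m_count_eq[OF S L] m_count_eq[OF aS L] R
    using sub by (intro H.card_dvd_of_subgroups subgroup_ann sR L) (auto simp: ann_def)
qed

lemma m_count_dvd_independent:
  assumes S: "S \<subseteq> {..<length A}" and a: "a < length A"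
    and r: "r_sub G A (insert a S) = r_sub G A S + 1"
    and L: "comm_group L" "torsionwise_finite L"
  shows "m_count G A S L dvd m_count G A (insert a S) L"
proof -
  let ?T = "insert a S"
  have T: "?T \<subseteq> {..<length A}" using S a by simp
  have "a \<notin> S" using r by (auto simp: insert_absorb)
  then have "?T - S = {a}" by blast
  then have ind: "independent_over S ?T" using r T by (intro independent_overI) auto
  interpret L: comm_group L by fact
  have "m_count G A ?T L = card {f \<in> dual_homs L ?T. \<forall>y\<in>tor_carrier L ?T. f y \<in> tor_image ?T ?T}"
    using m_count_dual[OF ind T _ _ L] by auto
  \<comment> \<open>For the full index set the constraint on the values is void, so the whole group
    is counted.\<close>
  also have "{f \<in> dual_homs L ?T. \<forall>y\<in>tor_carrier L ?T. f y \<in> tor_image ?T ?T} = dual_homs L ?T"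
    using dual_homs_closed[OF T] by auto
  finally have mT: "m_count G A ?T L = card (dual_homs L ?T)" .
  have mS: "m_count G A S L = card {f \<in> dual_homs L ?T. \<forall>y\<in>tor_carrier L ?T. f y \<in> tor_image ?T S}"
    using m_count_dual[OF ind T _ _ L] by auto
  have "group (torsion_part L (order (torsion_subgroup (G Mod span ?T))))"
    using L.comm_group_torsion_part by (rule comm_group.axioms)
  then show ?thesis
    unfolding mT mS dual_homs_def tor_carrier_def
    by (intro card_homs_constrained_dvd comm_group_torsion[OF T] subset_refl subgroup_tor_image[OF T]) auto
qed

lemma alternating_sum_dependent:
  assumes T: "S \<subseteq> T" "T \<subseteq> {..<length A}" and r: "r_sub G A S = r_sub G A T"
    and L: "comm_group L" "torsionwise_finite L"
  shows "(\<Sum>B | S \<subseteq> B \<and> B \<subseteq> T. (-1::int) ^ (card B - card S) * int (m_count G A B L)) \<ge> 0"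
proof -
  let ?R = "rad G (span S)"
  have S: "S \<subseteq> {..<length A}" using T by blast
  have fin: "finite T" using T(2) finite_subset by blast
  have sR: "subgroup ?R G" by (rule rad_subgroup[OF subgroup_span[OF S]])
  have RB: "rad G (span B) = ?R" if "S \<subseteq> B" "B \<subseteq> T" for B
  proof (rule rad_span_eq[OF that(1)])
    show "B \<subseteq> {..<length A}" using that T by blast
    show "r_sub G A S = r_sub G A B"
      using r_bounds(1)[OF that(1)] r_bounds(1)[OF that(2) T(2)] r that T by simp
  qed
  let ?U = "ann G L ?R (span S)"
  \<comment> \<open>An infinite \<open>?U\<close> would have \<open>card\<close> 0, but this number
    also counts a finite set of homomorphisms that contains the trivial one.\<close>
  have finU: "finite ?U"
  proof (rule ccontr)
    assume "infinite ?U"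
    then have "m_count G A S L = 0" using m_count_eq[OF S L(1)] by simp
    moreover have "finite (hom (torsion_subgroup (G Mod span S)) L \<inter> extensional (carrier (torsion_subgroup (G Mod span S))))"
      using finite_homs[OF _ comm_group_torsion(2)[OF S] L] comm_group_torsion(1)[OF S]
      by (simp add: homs_def comm_group.axioms)
    moreover have "(\<lambda>x\<in>carrier (torsion_subgroup (G Mod span S)). \<one>\<^bsub>L\<^esub>)
      \<in> hom (torsion_subgroup (G Mod span S)) L \<inter> extensional (carrier (torsion_subgroup (G Mod span S)))"
    proof -
      interpret L: comm_group L by fact
      interpret Q: comm_group "torsion_subgroup (G Mod span S)" by (rule comm_group_torsion[OF S])
      show ?thesis by (auto simp: hom_def)
    qed
    ultimately show False by (auto simp: m_count_def Let_def)
  qed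
  have summand: "(-1::int) ^ (card (S \<union> E) - card S) * int (m_count G A (S \<union> E) L)
      = (-1) ^ card E * int (card {f \<in> ?U. \<forall>i\<in>E. f (A ! i) = \<one>\<^bsub>L\<^esub>})" if E: "E \<in> Pow (T - S)" for E
  proof -
    have SE: "S \<subseteq> S \<union> E" "S \<union> E \<subseteq> T" "S \<union> E \<subseteq> {..<length A}" using E T by auto
    have "finite S" "finite E" "S \<inter> E = {}"
      using E finite_subset[OF T(1) fin] finite_subset[OF _ fin, of E] by auto
    then have "card (S \<union> E) - card S = card E" by (simp add: card_Un_disjoint)
    moreover have gens: "(\<lambda>i. A ! i) ` (S \<union> E) \<subseteq> ?R"
      using RB[OF SE(1,2)] subset_rad[OF subgroup_span[OF SE(3)]] nth_in_span[of _ "S \<union> E"] by blast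
    have "ann G L ?R (span (S \<union> E)) = {f \<in> ?U. \<forall>i\<in>E. f (A ! i) = \<one>\<^bsub>L\<^esub>}"
    proof -
      have "ann G L ?R (span (S \<union> E)) = ann G L ?R ((\<lambda>i. A ! i) ` (S \<union> E))"
        unfolding span_sub_def[of G A "S \<union> E"] using sR gens L(1) by (rule ann_generate)
      also have "\<dots> = {f \<in> ann G L ?R ((\<lambda>i. A ! i) ` S). \<forall>i\<in>E. f (A ! i) = \<one>\<^bsub>L\<^esub>}"
        by (auto simp: ann_def)
      also have "ann G L ?R ((\<lambda>i. A ! i) ` S) = ?U"
      proof -
        have "(\<lambda>i. A ! i) ` S \<subseteq> ?R" using gens by blast
        from ann_generate[OF sR this L(1)] show ?thesis by (simp only: span_sub_def)
      qed
      finally show ?thesis .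
    qed
    ultimately show ?thesis using m_count_eq[OF SE(3) L(1)] RB[OF SE(1,2)] by simp
  qed
  have "bij_betw (\<lambda>E. S \<union> E) (Pow (T - S)) {B. S \<subseteq> B \<and> B \<subseteq> T}"
    by (rule bij_betw_byWitness[where f' = "\<lambda>B. B - S"]) (use T in auto)
  from sum.reindex_bij_betw[OF this, of "\<lambda>B. (-1::int) ^ (card B - card S) * int (m_count G A B L)"]
  have "(\<Sum>B | S \<subseteq> B \<and> B \<subseteq> T. (-1::int) ^ (card B - card S) * int (m_count G A B L))
    = (\<Sum>E\<in>Pow (T - S). (-1) ^ card E * int (card {f \<in> ?U. \<forall>i\<in>E. f (A ! i) = \<one>\<^bsub>L\<^esub>}))"
    using summand by simp
  also have "\<dots> = int (card {f \<in> ?U. \<forall>i\<in>T - S. \<not> f (A ! i) = \<one>\<^bsub>L\<^esub>})"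
    using fin finU by (intro sum_Pow_alternating_card) auto
  finally show ?thesis by simp
qed

lemma alternating_sum_independent:
  assumes T: "S \<subseteq> T" "T \<subseteq> {..<length A}" and r: "r_sub G A T = r_sub G A S + card (T - S)"
    and L: "comm_group L" "torsionwise_finite L"
  shows "(\<Sum>B | S \<subseteq> B \<and> B \<subseteq> T. (-1::int) ^ (card T - card B) * int (m_count G A B L)) \<ge> 0"
proof -
  have fin: "finite T" using T(2) finite_subset by blast
  have ind: "independent_over S T" using T r by (rule independent_overI)
  \<comment> \<open>Here \<open>E\<close> is the complement \<open>T - B\<close>, which explains the
    sign. Property \<open>i\<close> says that all values of \<open>f\<close> lie in the subgroup
    belonging to \<open>T - {i}\<close>; the sum counts the \<open>f\<close> for which this fails at
    every \<open>i\<close>.\<close>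
  let ?P = "\<lambda>f i. \<forall>y\<in>tor_carrier L T. f y \<in> tor_image T (T - {i})"
  have summand: "(-1::int) ^ (card T - card (T - E)) * int (m_count G A (T - E) L)
      = (-1) ^ card E * int (card {f \<in> dual_homs L T. \<forall>i\<in>E. ?P f i})" if E: "E \<in> Pow (T - S)" for E
  proof -
    have ET: "E \<subseteq> T - S" "finite E" using E finite_subset[OF _ fin, of E] by auto
    have "card T - card (T - E) = card E"
    proof -
      have "E \<subseteq> T" using ET by blast
      then show ?thesis using ET(2) card_mono[OF fin \<open>E \<subseteq> T\<close>] by (simp add: card_Diff_subset)
    qed
    moreover have "m_count G A (T - E) L = card {f \<in> dual_homs L T. \<forall>y\<in>tor_carrier L T. f y \<in> tor_image T (T - E)}"
      using m_count_dual[OF ind T(2) _ _ L, of "T - E"] ET T(1) by auto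
    moreover have "{f \<in> dual_homs L T. \<forall>y\<in>tor_carrier L T. f y \<in> tor_image T (T - E)}
      = {f \<in> dual_homs L T. \<forall>i\<in>E. ?P f i}"
    proof (intro Collect_cong conj_cong refl)
      fix f assume f: "f \<in> dual_homs L T"
      have "f y \<in> tor_image T (T - E) \<longleftrightarrow> (\<forall>i\<in>E. f y \<in> tor_image T (T - {i}))"
        if "y \<in> tor_carrier L T" for y
        using tor_image_Diff_iff[OF ind T(2,1) ET(2,1) dual_homs_closed[OF T(2) f that]] .
      then show "(\<forall>y\<in>tor_carrier L T. f y \<in> tor_image T (T - E)) \<longleftrightarrow> (\<forall>i\<in>E. ?P f i)" by auto
    qed
    ultimately show ?thesis by simp
  qed
  have "bij_betw (\<lambda>E. T - E) (Pow (T - S)) {B. S \<subseteq> B \<and> B \<subseteq> T}"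
    by (rule bij_betw_byWitness[where f' = "\<lambda>B. T - B"]) (use T in auto)
  from sum.reindex_bij_betw[OF this, of "\<lambda>B. (-1::int) ^ (card T - card B) * int (m_count G A B L)"]
  have "(\<Sum>B | S \<subseteq> B \<and> B \<subseteq> T. (-1::int) ^ (card T - card B) * int (m_count G A B L))
    = (\<Sum>E\<in>Pow (T - S). (-1) ^ card E * int (card {f \<in> dual_homs L T. \<forall>i\<in>E. ?P f i}))"
    using summand by simp
  also have "\<dots> = int (card {f \<in> dual_homs L T. \<forall>i\<in>T - S. \<not> ?P f i})"
    using fin finite_dual_homs[OF T(2) L] by (intro sum_Pow_alternating_card) auto
  finally show ?thesis by simp
qed

section \<open>Extension into divisible groups and the product formula\<close>

lemma hom_extend_divisible:
  assumes L: "comm_group L" "divisible_group L" and D: "subgroup D G" and f: "f \<in> hom (G\<lparr>carrier := D\<rparr>) L"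
  shows "\<exists>F\<in>hom G L. \<forall>x\<in>D. F x = f x"
proof -
  obtain Y where Y: "finite Y" "Y \<subseteq> carrier G" "generate G Y = carrier G"
    using fin_gen by (auto simp: fin_gen_group_def)
  have "\<exists>D' F. subgroup D' G \<and> D \<subseteq> D' \<and> Y \<subseteq> D' \<and> F \<in> hom (G\<lparr>carrier := D'\<rparr>) L \<and> (\<forall>h\<in>D. F h = f h)"
  \<comment> \<open>Divisibility supplies every root, and finitely many generators suffice to reach
    the whole group.\<close>
  proof (rule hom_extend_finite[OF L(1) D f Y(1,2)])
    fix D' F a and k :: nat
    assume "F \<in> hom (G\<lparr>carrier := D'\<rparr>) L" "0 < k" "a [^] k \<in> D'"
    then show "\<exists>g\<in>carrier L. g [^]\<^bsub>L\<^esub> k = F (a [^] k)"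
      using L(2) unfolding divisible_group_def by (auto simp: hom_def)
  qed
  then obtain D' F where DF: "subgroup D' G" "Y \<subseteq> D'" "F \<in> hom (G\<lparr>carrier := D'\<rparr>) L" "\<forall>h\<in>D. F h = f h"
    by blast
  have "D' = carrier G" using generate_subgroup_incl[OF DF(2,1)] Y(3) subgroup.subset[OF DF(1)] by auto
  then show ?thesis using DF by auto
qed

text \<open>Triviality on \<open>R \<inter> N\<close> is exactly what allows \<open>f\<close> on
  \<open>R\<close> to be glued with the trivial map on \<open>N\<close>.\<close>

lemma ann_extend:
  assumes L: "comm_group L" "divisible_group L"
    and R: "subgroup R G" "subgroup R' G" "R \<subseteq> R'" and N: "subgroup N G" "N \<subseteq> R'"
    and f: "f \<in> ann G L R (R \<inter> N)"
  shows "\<exists>F\<in>ann G L R' N. restrict F R = f"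
proof -
  interpret L: comm_group L by fact
  have fh: "f \<in> homs (G\<lparr>carrier := R\<rparr>) L" and f1: "\<forall>n\<in>R \<inter> N. f n = \<one>\<^bsub>L\<^esub>" using f by (auto simp: ann_def)
  have gN: "group (G\<lparr>carrier := N\<rparr>)" using N(1) by (rule subgroup_imp_group)
  have inc: "(\<lambda>x. x) \<in> hom (G\<lparr>carrier := N\<rparr>) G"
    using subgroup.subset[OF N(1)] by (auto simp: hom_def)
  have triv: "(\<lambda>x. \<one>\<^bsub>L\<^esub>) \<in> hom (G\<lparr>carrier := N\<rparr>) L" by (simp add: hom_def)
  have "\<forall>n\<in>carrier (G\<lparr>carrier := N\<rparr>). n \<in> R \<longrightarrow> f n = \<one>\<^bsub>L\<^esub>" using f1 by simp
  from hom_glue[OF L(1) R(1) homsD(4)[OF fh] gN inc triv this]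
  obtain D F where DF: "subgroup D G" "R \<subseteq> D" "N \<subseteq> D" "F \<in> hom (G\<lparr>carrier := D\<rparr>) L"
    "\<forall>h\<in>R. F h = f h" "\<forall>n\<in>N. F n = \<one>\<^bsub>L\<^esub>"
    by auto
  \<comment> \<open>The extension goes up to the whole group, which is the one given as finitely
    generated, and is then cut back to \<open>R'\<close>.\<close>
  obtain F' where F': "F' \<in> hom G L" "\<forall>x\<in>D. F' x = F x"
    using hom_extend_divisible[OF L DF(1,4)] by blast
  have R'G: "R' \<subseteq> carrier G" using R(2) subgroup.subset by blast
  have "restrict F' R' \<in> homs (G\<lparr>carrier := R'\<rparr>) L"
    using F'(1) R'G subgroup.m_closed[OF R(2)] by (intro homsI) (auto simp: hom_def subset_iff)
  then have "restrict F' R' \<in> ann G L R' N" using F'(2) DF(3,6) N(2) by (auto simp: ann_def)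
  moreover have "restrict (restrict F' R') R = f"
  proof
    fix x show "restrict (restrict F' R') R x = f x"
      using F'(2) DF(2,5) R(3) homsD(3)[OF fh, of x] by (cases "x \<in> R") auto
  qed
  ultimately show ?thesis by blast
qed

lemma m_count_molecule:
  assumes L: "comm_group L" "divisible_group L"
    and T: "T \<subseteq> {..<length A}" "T = S \<union> B \<union> C" and disj: "S \<inter> B = {}" "S \<inter> C = {}" "B \<inter> C = {}"
    and r: "\<And>R. S \<subseteq> R \<Longrightarrow> R \<subseteq> T \<Longrightarrow> r_sub G A R = r_sub G A S + card (R \<inter> B)"
  shows "m_count G A S L * m_count G A T L = m_count G A (S \<union> B) L * m_count G A (S \<union> C) L"
proof -
  interpret L: comm_group L by fact
  have idx: "S \<subseteq> {..<length A}" "S \<union> B \<subseteq> {..<length A}" "S \<union> C \<subseteq> {..<length A}" using T by auto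
  let ?R = "rad G (span S)" and ?R' = "rad G (span (S \<union> B))"
  note s = subgroup_span[OF idx(1)] subgroup_span[OF idx(2)] subgroup_span[OF idx(3)] subgroup_span[OF T(1)]
  have sR: "subgroup ?R G" "subgroup ?R' G" using s rad_subgroup by auto
  have RR': "?R \<subseteq> ?R'" by (intro rad_mono span_mono) auto
  have sT: "S \<union> C \<subseteq> T" "S \<union> B \<subseteq> T" "S \<subseteq> T" using T(2) by auto
  have "(S \<union> C) \<inter> B = {}" using disj by blast
  then have rC: "r_sub G A S = r_sub G A (S \<union> C)" using r[OF _ sT(1)] by simp
  \<comment> \<open>The elements of \<open>C\<close> contribute no rank, so only two radicals occur:
    one for \<open>S\<close> and \<open>S \<union> C\<close>, one for \<open>S \<union> B\<close>
    and \<open>T\<close>.\<close>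
  have RC: "rad G (span (S \<union> C)) = ?R" using idx(3) rC by (intro rad_span_eq) auto
  have "T \<inter> B = (S \<union> B) \<inter> B" using T by auto
  then have "r_sub G A (S \<union> B) = r_sub G A T" using r[OF _ sT(2)] r[OF sT(3) subset_refl] by simp
  then have RT: "rad G (span T) = ?R'" using T by (intro rad_span_eq) auto
  have "(S \<union> B) \<inter> B = (S \<union> B) - S" using disj by blast
  then have "r_sub G A (S \<union> B) = r_sub G A S + card ((S \<union> B) - S)" using r[OF _ sT(2)] by simp
  then have ind: "independent_over S (S \<union> B)" using idx(2) by (intro independent_overI) auto
  have RB: "?R \<inter> span (S \<union> B) = span S" using ind idx(2) by (intro rad_span_Int_span) auto
  have sub: "span (S \<union> B) \<subseteq> ?R'" "span T \<subseteq> ?R'" "span (S \<union> C) \<subseteq> ?R"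
    using subset_rad[OF s(2)] subset_rad[OF s(4)] subset_rad[OF s(3)] RT RC by simp_all
  have CR: "A ! i \<in> ?R" if "i \<in> C" for i using nth_in_span[of i "S \<union> C"] that sub(3) by blast
  let ?P = "ann G L ?R' (span (S \<union> B))" and ?P' = "ann G L ?R' (span T)"
  let ?Q = "ann G L ?R (span S)" and ?Q' = "ann G L ?R (span (S \<union> C))"
  have P'I: "f \<in> ?P'" if f: "f \<in> ?P" and fC: "\<forall>i\<in>C. f (A ! i) = \<one>\<^bsub>L\<^esub>" for f
  proof -
    have gens: "(\<lambda>i. A ! i) ` T \<subseteq> ?R'" using nth_in_span[of _ T] sub(2) by blast
    have "f (A ! i) = \<one>\<^bsub>L\<^esub>" if "i \<in> T" for i
    proof (cases "i \<in> C")
      case False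
      then have "A ! i \<in> span (S \<union> B)" using that T(2) by (intro nth_in_span) blast
      then show ?thesis using f by (simp add: ann_def)
    qed (use fC in simp)
    then have "f \<in> ann G L ?R' ((\<lambda>i. A ! i) ` T)" using f by (auto simp: ann_def)
    then show ?thesis using ann_generate[OF sR(2) gens L(1)] by (simp add: span_sub_def)
  qed
  have PP': "?P' \<subseteq> ?P" using span_mono[of "S \<union> B" T] T(2) by (auto simp: ann_def)
  have res: "restrict f ?R \<in> homs (G\<lparr>carrier := ?R\<rparr>) L" if "f \<in> homs (G\<lparr>carrier := ?R'\<rparr>) L" for f
    using homsD(1,2)[OF that] RR' subgroup.m_closed[OF sR(1)] by (intro homsI) (auto simp: subset_iff)
  have sS: "h \<in> ?R \<and> h \<in> span (S \<union> B)" if "h \<in> span S" for h using RB that by blast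
  have imP: "(\<lambda>f. restrict f ?R) ` ?P = ?Q"
  proof
    show "(\<lambda>f. restrict f ?R) ` ?P \<subseteq> ?Q"
      using res sS by (auto simp: ann_def)
    show "?Q \<subseteq> (\<lambda>f. restrict f ?R) ` ?P"
    proof
      fix f assume "f \<in> ?Q"
      then have "f \<in> ann G L ?R (?R \<inter> span (S \<union> B))" using RB by simp
      from ann_extend[OF L sR RR' s(2) sub(1) this] show "f \<in> (\<lambda>f. restrict f ?R) ` ?P" by blast
    qed
  qed
  have imP': "(\<lambda>f. restrict f ?R) ` ?P' = ?Q'"
  proof
    have "span (S \<union> C) \<subseteq> span T" using T(2) by (intro span_mono) auto
    then have "h \<in> ?R \<and> h \<in> span T" if "h \<in> span (S \<union> C)" for h using sub(3) that by blast
    then show "(\<lambda>f. restrict f ?R) ` ?P' \<subseteq> ?Q'"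
      using res by (auto simp: ann_def)
    show "?Q' \<subseteq> (\<lambda>f. restrict f ?R) ` ?P'"
    proof
      fix f assume f: "f \<in> ?Q'"
      have "span S \<subseteq> span (S \<union> C)" by (intro span_mono) auto
      then have "f \<in> ?Q" using f by (auto simp: ann_def)
      then obtain F where F: "F \<in> ?P" "f = restrict F ?R" using imP by blast
      \<comment> \<open>The generators from \<open>C\<close> lie in the smaller radical, where
        \<open>F\<close> coincides with \<open>f\<close>; an extension found for
        \<open>S \<union> B\<close> therefore respects \<open>C\<close> automatically.\<close>
      have "F (A ! i) = \<one>\<^bsub>L\<^esub>" if "i \<in> C" for i
      proof -
        have "f (A ! i) = \<one>\<^bsub>L\<^esub>" using f nth_in_span[of i "S \<union> C"] that by (auto simp: ann_def)
        then show ?thesis using F(2) CR[OF that] by simp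
      qed
      then have "F \<in> ?P'" using P'I[OF F(1)] by blast
      then show "f \<in> (\<lambda>f. restrict f ?R) ` ?P'" using F(2) by blast
    qed
  qed
  \<comment> \<open>Vanishing on the smaller radical includes vanishing on the generators from
    \<open>C\<close>.\<close>
  have ker: "{f \<in> ?P'. \<forall>x\<in>?R. f x = \<one>\<^bsub>L\<^esub>} = {f \<in> ?P. \<forall>x\<in>?R. f x = \<one>\<^bsub>L\<^esub>}"
    using P'I PP' CR by blast
  have "card ?P = card ?Q * card {f \<in> ?P. \<forall>x\<in>?R. f x = \<one>\<^bsub>L\<^esub>}"
    using card_restriction_fibers[OF sR RR' L(1) subgroup_ann[OF sR(2) sub(1) L(1)]] imP by simp
  moreover have "card ?P' = card ?Q' * card {f \<in> ?P. \<forall>x\<in>?R. f x = \<one>\<^bsub>L\<^esub>}"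
    using card_restriction_fibers[OF sR RR' L(1) subgroup_ann[OF sR(2) sub(2) L(1)]] imP' ker by simp
  \<comment> \<open>Both fibre formulas contain the same kernel factor, so cross-multiplying them
    yields the identity without any division.\<close>
  ultimately show ?thesis
    using m_count_eq[OF idx(1) L(1)] m_count_eq[OF idx(2) L(1)] m_count_eq[OF idx(3) L(1)]
      m_count_eq[OF T(1) L(1)] RC RT by (simp add: ac_simps)
qed

end

theorem mainTheorem17:
  fixes Gm :: "('a,'m) monoid_scheme" and G :: "('b,'n) monoid_scheme" and A :: "'a list"
  assumes "comm_group Gm" and "fin_gen_group Gm" and "set A \<subseteq> carrier Gm"
    and "comm_group G" and "torsionwise_finite G"
  shows
   "(\<forall>S a. S \<subseteq> {..<length A} \<and> a < length A \<and> r_sub Gm A (insert a S) = r_sub Gm A S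
        \<longrightarrow> m_count Gm A (insert a S) G dvd m_count Gm A S G)
  \<and> (\<forall>S a. S \<subseteq> {..<length A} \<and> a < length A \<and> r_sub Gm A (insert a S) = r_sub Gm A S + 1
        \<longrightarrow> m_count Gm A S G dvd m_count Gm A (insert a S) G)
  \<and> (\<forall>S T. S \<subseteq> T \<and> T \<subseteq> {..<length A} \<and> r_sub Gm A S = r_sub Gm A T
        \<longrightarrow> (\<Sum>B | S \<subseteq> B \<and> B \<subseteq> T. (-1::int) ^ (card B - card S) * int (m_count Gm A B G)) \<ge> 0)
  \<and> (\<forall>S T. S \<subseteq> T \<and> T \<subseteq> {..<length A} \<and> r_sub Gm A T = r_sub Gm A S + card (T - S)
        \<longrightarrow> (\<Sum>B | S \<subseteq> B \<and> B \<subseteq> T. (-1::int) ^ (card T - card B) * int (m_count Gm A B G)) \<ge> 0)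
  \<and> (divisible_group G \<longrightarrow>
      (\<forall>S T B C. T \<subseteq> {..<length A} \<and> T = S \<union> B \<union> C \<and> S \<inter> B = {} \<and> S \<inter> C = {} \<and> B \<inter> C = {}
         \<and> (\<forall>R. S \<subseteq> R \<and> R \<subseteq> T \<longrightarrow> r_sub Gm A R = r_sub Gm A S + card (R \<inter> B))
        \<longrightarrow> m_count Gm A S G * m_count Gm A T G = m_count Gm A (S \<union> B) G * m_count Gm A (S \<union> C) G))"
proof -
  interpret arrangement Gm A
    using assms by (simp add: arrangement_def arrangement_axioms_def)
  note L = \<open>comm_group G\<close> \<open>torsionwise_finite G\<close>
  show ?thesis
  proof (intro conjI allI impI; (elim conjE)?)
    fix S a assume "S \<subseteq> {..<length A}" "a < length A" "r_sub Gm A (insert a S) = r_sub Gm A S"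
    then show "m_count Gm A (insert a S) G dvd m_count Gm A S G"
      using L(1) by (rule m_count_dvd_dependent)
  next
    fix S a assume "S \<subseteq> {..<length A}" "a < length A" "r_sub Gm A (insert a S) = r_sub Gm A S + 1"
    then show "m_count Gm A S G dvd m_count Gm A (insert a S) G"
      using L by (rule m_count_dvd_independent)
  next
    fix S T assume "S \<subseteq> T" "T \<subseteq> {..<length A}" "r_sub Gm A S = r_sub Gm A T"
    then show "(\<Sum>B | S \<subseteq> B \<and> B \<subseteq> T. (-1::int) ^ (card B - card S) * int (m_count Gm A B G)) \<ge> 0"
      using L by (rule alternating_sum_dependent)
  next
    fix S T assume "S \<subseteq> T" "T \<subseteq> {..<length A}" "r_sub Gm A T = r_sub Gm A S + card (T - S)"
    then show "(\<Sum>B | S \<subseteq> B \<and> B \<subseteq> T. (-1::int) ^ (card T - card B) * int (m_count Gm A B G)) \<ge> 0"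
      using L by (rule alternating_sum_independent)
  next
    fix S T B C
    assume "divisible_group G" "T \<subseteq> {..<length A}" "T = S \<union> B \<union> C" "S \<inter> B = {}" "S \<inter> C = {}" "B \<inter> C = {}"
      "\<forall>R. S \<subseteq> R \<and> R \<subseteq> T \<longrightarrow> r_sub Gm A R = r_sub Gm A S + card (R \<inter> B)"
    then show "m_count Gm A S G * m_count Gm A T G = m_count Gm A (S \<union> B) G * m_count Gm A (S \<union> C) G"
      using m_count_molecule[OF L(1), of T S B C] by blast
  qed
qed


end
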